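(* Let $K,K'\subset\mathbb{R}^n$ be closed sets whose complements $K^c,(K')^c$ are bounded open sets. Let $\alpha>0$, $\mu\in(0,1]$ and $\lambda>0$, and suppose that for some $\alpha'$ with $0\le\alpha'<\alpha$ one has $r_\mu^{\alpha'}(K)>\alpha+\lambda$ and $r_\mu^{\alpha'}(K')>\alpha+\lambda$, and that $(K^{\oplus\alpha})^c$ and $(K'^{\oplus\alpha})^c$ are connected. Put $R_{\max}=\max(R_{\max}(K),R_{\max}(K'))$, $\tilde\mu=\min\big(\tilde\mu_{\mu,\lambda}^{\alpha,\alpha}(K),\tilde\mu_{\mu,\lambda}^{\alpha,\alpha}(K')\big)$ and $$C=\frac{22}{3}\,\frac{R_{\max}^2}{\alpha^{1/2}\tilde\mu^{3/2}\lambda}.$$ Assume $d_H(K,K')<\epsilon$ where $$\epsilon<\min\left(\frac{\lambda^2\alpha\tilde\mu}{16R_{\max}^2},\ \frac{\lambda^2}{16\alpha\tilde\mu},\ \frac{9\lambda^4\alpha\tilde\mu^3}{400R_{\max}^4},\ \Big(\frac{2\alpha}{C}\Big)^2,\ \Big(\frac{\lambda^2\alpha\tilde\mu}{16R_{\max}^2C}\Big)^2,\ \Big(\frac{\lambda^2}{16\alpha\tilde\mu C}\Big)^2\right).$$ Let $D=\max\big(\mathrm{Gdiam}(\mathrm{ax}_\lambda^\alpha(K)),\mathrm{Gdiam}(\mathrm{ax}_\lambda^\alpha(K'))\big)$. Then $D<\infty$ and the Gromov–Hausdorff distance between $\mathrm{ax}_\lambda^\alpha(K)$ and $\mathrm{ax}_\lambda^\alpha(K')$,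 each equipped with its intrinsic (geodesic) metric, satisfies $$d_{GH}\big(\mathrm{ax}_\lambda^\alpha(K),\mathrm{ax}_\lambda^\alpha(K')\big)\le 2C^{3/2}\epsilon^{1/4}+2C\epsilon^{1/2}e^{C^{3/2}\epsilon^{1/4}/\alpha}+D\big(e^{C^{3/2}\epsilon^{1/4}/\alpha}-1\big)=O(\epsilon^{1/4}).$$
   Context: For a closed set $K\subset\mathbb{R}^n$ with bounded open complement: $R_K(x)=d(x,K)$; $\Theta_K(x)=\{y\in K:\|x-y\|=R_K(x)\}$; for bounded $S$, $\mathrm{center}(S)$ and $\mathrm{radius}(S)$ are the center and radius of the smallest ball enclosing $S$; $\mathcal F_K(x)=\mathrm{radius}(\Theta_K(x))$; for $x\notin K$, $\nabla_K(x)=(x-\mathrm{center}(\Theta_K(x)))/R_K(x)$. $R_{\max}(K)=\max_{x\in K^c}R_K(x)$. The critical function is $\chi_K(t)=\inf\{\|\nabla_K(x)\|:R_K(x)=t\}$ for $t\in(0,R_{\max}(K)]$ (infimum of the empty set is $1$). For $\alpha\ge0$, $K^{\oplus\alpha}=\{x:d(x,K)\le\alpha\}$. For $\mu\in(0,1]$, $\alpha\ge 0$: $r_\mu^\alpha(K)=\inf\{t>\alpha:\chi_K(t)<\mu\}$. The $(\lambda,\alpha)$-medial axis is $\mathrm{ax}_\lambda^\alpha(K)=\{x\in\mathbb{R}^n:\mathcal F_{K^{\oplus\alpha}}(x)\ge\lambda\}$. Define $\tilde\mu_{\mu,\lambda}^{\alpha,\alpha'}(K)=\min\big(\mu,\sqrt{1-(\lambda/(r_\mu^{\alpha'}(K)-\alpha))^2}\big)$.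 The intrinsic metric on a set $A\subset\mathbb{R}^n$ is $d_A(x,y)=\inf$ of lengths of rectifiable paths in $A$ from $x$ to $y$; $\mathrm{Gdiam}(A)=\sup_{x,y\in A}d_A(x,y)$. $d_H$ is the Hausdorff distance. An $\varepsilon$-relation between metric spaces $X_1,X_2$ is $\mathcal R\subset X_1\times X_2$ whose projections to both factors are surjective and such that $|d_{X_1}(x_1,x_1')-d_{X_2}(x_2,x_2')|<\varepsilon$ for all $(x_1,x_2),(x_1',x_2')\in\mathcal R$; $d_{GH}(X_1,X_2)$ is the infimum of $\varepsilon$ for which an $\varepsilon$-relation exists. *)

theory Defs
  imports "HOL-Analysis.Analysis" "HOL-Library.Extended_Real"
begin

definition Rdist :: "'a::euclidean_space set \<Rightarrow> 'a \<Rightarrow> real" where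
  "Rdist K x = infdist x K"

definition Theta :: "'a::euclidean_space set \<Rightarrow> 'a \<Rightarrow> 'a set" where
  "Theta K x = {y \<in> K. dist x y = Rdist K x}"

definition enc_radius :: "'a::euclidean_space set \<Rightarrow> real" where
  "enc_radius S = Inf {r. \<exists>c. S \<subseteq> cball c r}"

definition enc_center :: "'a::euclidean_space set \<Rightarrow> 'a" where
  "enc_center S = (SOME c. S \<subseteq> cball c (enc_radius S))"

definition FK :: "'a::euclidean_space set \<Rightarrow> 'a \<Rightarrow> real" where
  "FK K x = enc_radius (Theta K x)"

definition gradK :: "'a::euclidean_space set \<Rightarrow> 'a \<Rightarrow> 'a" where
  "gradK K x = (1 / Rdist K x) *\<^sub>R (x - enc_center (Theta K x))"

definition Rmax :: "'a::euclidean_space set \<Rightarrow> real" where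
  "Rmax K = Sup (Rdist K ` (- K))"

definition chiK :: "'a::euclidean_space set \<Rightarrow> real \<Rightarrow> real" where
  "chiK K t = (if {x. Rdist K x = t} = {} then 1
               else Inf ((\<lambda>x. norm (gradK K x)) ` {x. Rdist K x = t}))"

definition offset :: "'a::euclidean_space set \<Rightarrow> real \<Rightarrow> 'a set" where
  "offset K \<alpha> = {x. infdist x K \<le> \<alpha>}"

text \<open>$r_\mu^\alpha(K)$, with value $+\infty$ when the set is empty.\<close>
definition r_mu :: "real \<Rightarrow> real \<Rightarrow> 'a::euclidean_space set \<Rightarrow> ereal" where
  "r_mu \<mu> \<alpha> K = Inf (ereal ` {t. t > \<alpha> \<and> chiK K t < \<mu>})"

definition medial_axis :: "real \<Rightarrow> real \<Rightarrow> 'a::euclidean_space set \<Rightarrow> 'a set" where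
  "medial_axis lam \<alpha> K = {x. FK (offset K \<alpha>) x \<ge> lam}"

definition mu_tilde :: "real \<Rightarrow> real \<Rightarrow> real \<Rightarrow> real \<Rightarrow> 'a::euclidean_space set \<Rightarrow> real" where
  "mu_tilde \<mu> lam \<alpha> \<alpha>' K =
     (if r_mu \<mu> \<alpha>' K = \<infinity> then min \<mu> 1
      else min \<mu> (sqrt (1 - (lam / (real_of_ereal (r_mu \<mu> \<alpha>' K) - \<alpha>))\<^sup>2)))"

definition path_length :: "(real \<Rightarrow> 'a::euclidean_space) \<Rightarrow> ereal" where
  "path_length g = Sup {ereal (\<Sum>i<k. dist (g (t i)) (g (t (Suc i)))) | t k.
       t 0 = 0 \<and> t k = 1 \<and> (\<forall>i<k. t i \<le> t (Suc i))}"

definition rectifiable :: "(real \<Rightarrow> 'a::euclidean_space) \<Rightarrow> bool" where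
  "rectifiable g \<longleftrightarrow> path g \<and> path_length g < \<infinity>"

definition intrinsic_dist :: "'a::euclidean_space set \<Rightarrow> 'a \<Rightarrow> 'a \<Rightarrow> ereal" where
  "intrinsic_dist A x y = Inf {path_length g | g. rectifiable g \<and> path_image g \<subseteq> A
       \<and> pathstart g = x \<and> pathfinish g = y}"

definition Gdiam :: "'a::euclidean_space set \<Rightarrow> ereal" where
  "Gdiam A = Sup {intrinsic_dist A x y | x y. x \<in> A \<and> y \<in> A}"

text \<open>Hausdorff distance of (possibly unbounded) sets, as an extended real.\<close>
definition hdist :: "'a::euclidean_space set \<Rightarrow> 'a set \<Rightarrow> ereal" where
  "hdist S T = max (Sup ((\<lambda>x. ereal (infdist x T)) ` S)) (Sup ((\<lambda>y. ereal (infdist y S)) ` T))"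

definition eps_relation ::
  "'a set \<Rightarrow> ('a \<Rightarrow> 'a \<Rightarrow> real) \<Rightarrow> 'b set \<Rightarrow> ('b \<Rightarrow> 'b \<Rightarrow> real) \<Rightarrow> real \<Rightarrow> ('a \<times> 'b) set \<Rightarrow> bool" where
  "eps_relation X1 d1 X2 d2 \<epsilon> R \<longleftrightarrow> R \<subseteq> X1 \<times> X2 \<and> fst ` R = X1 \<and> snd ` R = X2 \<and>
     (\<forall>(x1, x2) \<in> R. \<forall>(x1', x2') \<in> R. \<bar>d1 x1 x1' - d2 x2 x2'\<bar> < \<epsilon>)"

definition dGH ::
  "'a set \<Rightarrow> ('a \<Rightarrow> 'a \<Rightarrow> real) \<Rightarrow> 'b set \<Rightarrow> ('b \<Rightarrow> 'b \<Rightarrow> real) \<Rightarrow> ereal" where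
  "dGH X1 d1 X2 d2 = Inf (ereal ` {\<epsilon>. \<epsilon> > 0 \<and> (\<exists>R. eps_relation X1 d1 X2 d2 \<epsilon> R)})"

end

theory Submission
  imports Defs
begin

text \<open>
  Instead of the gradient flow of the distance function \<open>R\<close> to \<open>K\<close> we use its implicit Euler steps
  \<open>prox h x = x + h p\<close>, where \<open>p\<close> is a supergradient of \<open>R\<close> at the new point. On \<open>R > \<alpha>\<close> the
  function \<open>R\<close> is semiconcave with constant \<open>1 / \<alpha>\<close>, so that a step is Lipschitz with constant
  \<open>1 / (1 - h / \<alpha>)\<close>, and \<open>n\<close> steps of size \<open>T / n\<close> have Lipschitz constant tending to
  \<open>exp (T / \<alpha>)\<close>. Moreover a step increases both \<open>R\<close> and \<open>FK K\<close>, hence maps the medial axis into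
  itself.

  If \<open>x\<close> lies in the medial axis of a \<open>\<delta>\<close>-close set \<open>K'\<close>, its trajectory enters the medial axis of
  \<open>K\<close> within time \<open>C * sqrt \<delta>\<close>: outside of it \<open>FK K\<close> stays below a bound \<open>M\<close>, which forces
  \<open>sqrt (R\<^sup>2 - M\<^sup>2)\<close> to grow at least by the length travelled, whereas the nearest points of \<open>K'\<close> at
  \<open>x\<close> bound the growth from above by the same expression with a definitely larger \<open>M\<close>. Comparing a
  set with its own translates, the same holds for points at distance \<open>\<delta>\<close> from the medial axis of
  \<open>K\<close>.

  Points of the two medial axes at distance at most \<open>T = C * sqrt \<epsilon>\<close> are related. A path in one medial
  axis, extended by two segments of length \<open>T\<close> at its ends, stays within \<open>T\<close> of the other one and is
  pushed into it in time \<open>C * sqrt T\<close>, which gives the comparison of intrinsic distances.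
\<close>

section \<open>Nearest points and enclosing balls\<close>

text \<open>The difference of the squared distances to \<open>z\<close> and \<open>x\<close> is
  affine in the point, so a lower bound on \<open>S\<close> is a half-space condition and carries
  over to the hull.\<close>

lemma hull_halfspace_bound:
  fixes x z w :: "'a::euclidean_space"
  assumes "w \<in> convex hull S" and "\<And>y. y \<in> S \<Longrightarrow> a \<le> (dist z y)\<^sup>2 - (dist x y)\<^sup>2"
  shows "a \<le> (dist z w)\<^sup>2 - (dist x w)\<^sup>2"
proof -
  have eq: "(dist z y)\<^sup>2 - (dist x y)\<^sup>2 = z \<bullet> z - x \<bullet> x - (2 *\<^sub>R (z - x)) \<bullet> y" for y
    by (simp add: dist_norm power2_norm_eq_inner algebra_simps inner_commute)
  have "convex hull S \<subseteq> {y. (2 *\<^sub>R (z - x)) \<bullet> y \<le> z \<bullet> z - x \<bullet> x - a}"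
  proof (rule hull_minimal)
    show "S \<subseteq> {y. (2 *\<^sub>R (z - x)) \<bullet> y \<le> z \<bullet> z - x \<bullet> x - a}"
    proof
      fix y assume "y \<in> S"
      from assms(2)[OF this] show "y \<in> {y. (2 *\<^sub>R (z - x)) \<bullet> y \<le> z \<bullet> z - x \<bullet> x - a}"
        unfolding eq by simp
    qed
  qed (rule convex_halfspace_le)
  then show ?thesis using assms(1) eq[of w] by auto
qed

lemma Theta_eq: "Theta K x = K \<inter> sphere x (Rdist K x)"
  by (auto simp: Theta_def)

lemma Rdist_nonneg: "0 \<le> Rdist K x"
  by (simp add: Rdist_def infdist_nonneg)

lemma Rdist_triangle: "Rdist K x \<le> Rdist K y + dist x y"
  by (simp add: Rdist_def infdist_triangle)

lemma continuous_on_Rdist: "continuous_on S (Rdist K)"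
  unfolding Rdist_def by (intro continuous_intros)

lemma compact_Theta: "closed K \<Longrightarrow> compact (Theta K x)"
  unfolding Theta_eq by (intro closed_Int_compact compact_sphere)

lemma Theta_nonempty:
  assumes "closed K" "K \<noteq> {}"
  shows "Theta K x \<noteq> {}"
proof -
  obtain y where "y \<in> K" "infdist x K = dist x y" using infdist_attains_inf[OF assms] by metis
  then have "y \<in> Theta K x" by (simp add: Theta_def Rdist_def)
  then show ?thesis by blast
qed

text \<open>Each nearest point \<open>v\<close> of \<open>y\<close> gives
  \<open>Rdist K z \<le> dist z v\<close>, and affinity extends the resulting bound to the hull.
  Semiconcavity and the gain per step both come from it.\<close>

lemma Rdist_le_hull_Theta:
  assumes "w \<in> convex hull Theta K y"
  shows "(Rdist K z)\<^sup>2 \<le> (dist z w)\<^sup>2 + (Rdist K y)\<^sup>2 - (dist y w)\<^sup>2"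
proof -
  have "(Rdist K z)\<^sup>2 - (Rdist K y)\<^sup>2 \<le> (dist z w)\<^sup>2 - (dist y w)\<^sup>2"
  proof (rule hull_halfspace_bound[OF assms])
    fix v assume v: "v \<in> Theta K y"
    then have "Rdist K z \<le> dist z v" "Rdist K y = dist y v"
      by (auto simp: Theta_def Rdist_def infdist_le)
    then show "(Rdist K z)\<^sup>2 - (Rdist K y)\<^sup>2 \<le> (dist z v)\<^sup>2 - (dist y v)\<^sup>2"
      using Rdist_nonneg[of K z] by (simp add: power_mono)
  qed
  then show ?thesis by simp
qed

lemma hull_Theta_subset_cball: "convex hull Theta K x \<subseteq> cball x (Rdist K x)"
  by (rule hull_minimal) (auto simp: Theta_def)

text \<open>This turns out to be the center of the smallest ball enclosing \<open>Theta K x\<close>;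
  as a projection it comes with a variational inequality.\<close>

definition foot :: "'a::euclidean_space set \<Rightarrow> 'a \<Rightarrow> 'a" where
  "foot K x = closest_point (convex hull Theta K x) x"

lemma foot_in_hull:
  assumes "closed K" "K \<noteq> {}"
  shows "foot K x \<in> convex hull Theta K x"
  unfolding foot_def
  by (rule closest_point_in_set)
    (use assms in \<open>auto simp: compact_Theta compact_convex_hull compact_imp_closed Theta_nonempty\<close>)

lemma foot_le:
  assumes "closed K" "w \<in> convex hull Theta K x"
  shows "dist x (foot K x) \<le> dist x w"
  unfolding foot_def
  by (rule closest_point_le)
    (use assms in \<open>auto simp: compact_Theta compact_convex_hull compact_imp_closed\<close>)

lemma dist_foot_le_Rdist:
  assumes "closed K" "K \<noteq> {}"
  shows "dist x (foot K x) \<le> Rdist K x"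
  using foot_in_hull[OF assms, of x] hull_Theta_subset_cball[of K x] by auto

text \<open>At a projection onto a convex set the angle between \<open>x\<close> and any point of
  the set is at least a right angle, and the cosine rule gives the radius.\<close>

lemma Theta_subset_cball_foot:
  assumes "closed K"
  shows "Theta K x \<subseteq> cball (foot K x) (sqrt ((Rdist K x)\<^sup>2 - (dist x (foot K x))\<^sup>2))"
proof
  fix y assume y: "y \<in> Theta K x"
  let ?c = "foot K x"
  have "(x - ?c) \<bullet> (y - ?c) \<le> 0"
    unfolding foot_def
    by (rule closest_point_dot)
      (use assms y in \<open>auto simp: compact_Theta compact_convex_hull compact_imp_closed hull_inc\<close>)
  moreover have "(dist x y)\<^sup>2 = (dist ?c y)\<^sup>2 + (dist x ?c)\<^sup>2 - 2 * ((x - ?c) \<bullet> (y - ?c))"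
    by (simp add: dist_norm power2_norm_eq_inner algebra_simps inner_commute)
  ultimately have "(dist ?c y)\<^sup>2 \<le> (Rdist K x)\<^sup>2 - (dist x ?c)\<^sup>2"
    using y by (auto simp: Theta_def)
  then show "y \<in> cball ?c (sqrt ((Rdist K x)\<^sup>2 - (dist x ?c)\<^sup>2))"
    by (simp add: real_le_rsqrt)
qed

text \<open>The half-space bound is evaluated at the foot. No enclosing ball beats the one around
  the foot, and the term in \<open>dist c (foot K x)\<close> makes the optimal center
  unique.\<close>

lemma enclosing_ball_Theta:
  assumes "closed K" "K \<noteq> {}" "Theta K x \<subseteq> cball c r"
  shows "0 \<le> r" and "(Rdist K x)\<^sup>2 - (dist x (foot K x))\<^sup>2 + (dist c (foot K x))\<^sup>2 \<le> r\<^sup>2"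
proof -
  obtain v where "v \<in> Theta K x" using Theta_nonempty assms by blast
  then have "dist c v \<le> r" using assms(3) by auto
  then show "0 \<le> r" using order_trans zero_le_dist by blast
  have "(Rdist K x)\<^sup>2 - r\<^sup>2 \<le> (dist x (foot K x))\<^sup>2 - (dist c (foot K x))\<^sup>2"
  proof (rule hull_halfspace_bound[OF foot_in_hull[OF assms(1,2)]])
    fix y assume y: "y \<in> Theta K x"
    then have "(dist c y)\<^sup>2 \<le> r\<^sup>2" using assms(3) by (intro power_mono) auto
    then show "(Rdist K x)\<^sup>2 - r\<^sup>2 \<le> (dist x y)\<^sup>2 - (dist c y)\<^sup>2"
      using y by (simp add: Theta_def)
  qed
  then show "(Rdist K x)\<^sup>2 - (dist x (foot K x))\<^sup>2 + (dist c (foot K x))\<^sup>2 \<le> r\<^sup>2" by simp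
qed

lemma FK_eq:
  assumes "closed K" "K \<noteq> {}"
  shows "FK K x = sqrt ((Rdist K x)\<^sup>2 - (dist x (foot K x))\<^sup>2)"
  unfolding FK_def enc_radius_def
proof (rule cInf_eq_minimum)
  show "sqrt ((Rdist K x)\<^sup>2 - (dist x (foot K x))\<^sup>2) \<in> {r. \<exists>c. Theta K x \<subseteq> cball c r}"
    using Theta_subset_cball_foot[OF assms(1), of x] by blast
  fix r assume "r \<in> {r. \<exists>c. Theta K x \<subseteq> cball c r}"
  then obtain c where c: "Theta K x \<subseteq> cball c r" by blast
  have "(Rdist K x)\<^sup>2 - (dist x (foot K x))\<^sup>2 \<le> r\<^sup>2"
    using enclosing_ball_Theta(2)[OF assms c] zero_le_power2[of "dist c (foot K x)"] by linarith
  then show "sqrt ((Rdist K x)\<^sup>2 - (dist x (foot K x))\<^sup>2) \<le> r"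
    using enclosing_ball_Theta(1)[OF assms c] by (simp add: real_le_lsqrt)
qed

lemma FK_power2:
  assumes "closed K" "K \<noteq> {}"
  shows "(FK K x)\<^sup>2 = (Rdist K x)\<^sup>2 - (dist x (foot K x))\<^sup>2"
proof -
  have "(dist x (foot K x))\<^sup>2 \<le> (Rdist K x)\<^sup>2"
    using dist_foot_le_Rdist[OF assms, of x] by (rule power_mono) simp
  then show ?thesis unfolding FK_eq[OF assms] by simp
qed

lemma FK_nonneg:
  assumes "closed K" "K \<noteq> {}"
  shows "0 \<le> FK K x"
proof -
  have "(dist x (foot K x))\<^sup>2 \<le> (Rdist K x)\<^sup>2"
    using dist_foot_le_Rdist[OF assms, of x] by (rule power_mono) simp
  then show ?thesis unfolding FK_eq[OF assms] by simp
qed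

lemma FK_le_Rdist:
  assumes "closed K" "K \<noteq> {}"
  shows "FK K x \<le> Rdist K x"
  by (rule power2_le_imp_le) (auto simp: FK_power2[OF assms] Rdist_nonneg)

lemma enc_center_eq:
  assumes "closed K" "K \<noteq> {}"
  shows "enc_center (Theta K x) = foot K x"
  unfolding enc_center_def
proof (rule some_equality)
  have r: "enc_radius (Theta K x) = FK K x" by (simp add: FK_def)
  show "Theta K x \<subseteq> cball (foot K x) (enc_radius (Theta K x))"
    using Theta_subset_cball_foot[OF assms(1), of x] by (simp add: r FK_eq[OF assms])
  fix c assume "Theta K x \<subseteq> cball c (enc_radius (Theta K x))"
  from enclosing_ball_Theta(2)[OF assms this] have "(dist c (foot K x))\<^sup>2 \<le> 0"
    by (simp add: r FK_power2[OF assms])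
  then show "c = foot K x" by simp
qed

lemma norm_gradK:
  assumes "closed K" "K \<noteq> {}"
  shows "norm (gradK K x) = dist x (foot K x) / Rdist K x"
  by (simp add: gradK_def enc_center_eq[OF assms] dist_norm Rdist_nonneg)

section \<open>Distances, nearest points and enclosing radii for offsets\<close>

lemma Rdist_offset:
  assumes "closed K" "K \<noteq> {}" "0 \<le> \<alpha>" "\<alpha> < Rdist K x"
  shows "Rdist (offset K \<alpha>) x = Rdist K x - \<alpha>"
proof (rule antisym)
  have ne: "offset K \<alpha> \<noteq> {}" using assms(2,3) by (auto simp: offset_def) (metis infdist_zero)
  have R: "Rdist K x > 0" using assms by simp
  obtain y where y: "y \<in> K" "dist x y = Rdist K x" using Theta_nonempty[OF assms(1,2), of x] by (auto simp: Theta_def)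
  \<comment> \<open>The point of the segment from \<open>x\<close> to \<open>y\<close> at distance
    \<open>\<alpha>\<close> from \<open>y\<close>.\<close>
  let ?z = "x + ((Rdist K x - \<alpha>) / Rdist K x) *\<^sub>R (y - x)"
  have "?z - y = (\<alpha> / Rdist K x) *\<^sub>R (x - y)" using R
    by (simp add: diff_divide_distrib algebra_simps)
  then have "dist ?z y = \<alpha>" using R y assms(3) by (simp add: dist_norm)
  then have "?z \<in> offset K \<alpha>" using y(1) by (auto simp: offset_def intro: infdist_le2)
  then have "Rdist (offset K \<alpha>) x \<le> dist x ?z" by (simp add: Rdist_def infdist_le)
  also have "\<dots> = Rdist K x - \<alpha>" using R y assms(4) by (simp add: dist_norm norm_minus_commute)
  finally show "Rdist (offset K \<alpha>) x \<le> Rdist K x - \<alpha>" .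
  have "Rdist K x - \<alpha> \<le> dist x z" if "z \<in> offset K \<alpha>" for z
    using that Rdist_triangle[of K x z] by (simp add: offset_def Rdist_def)
  then show "Rdist K x - \<alpha> \<le> Rdist (offset K \<alpha>) x"
    unfolding Rdist_def[of "offset K \<alpha>"] by (simp add: infdist_notempty[OF ne] cINF_greatest ne)
qed

lemma Theta_offset:
  assumes "closed K" "K \<noteq> {}" "0 \<le> \<alpha>" "\<alpha> < Rdist K x"
  shows "Theta (offset K \<alpha>) x = (\<lambda>y. x + ((Rdist K x - \<alpha>) / Rdist K x) *\<^sub>R (y - x)) ` Theta K x"
    (is "_ = ?f ` _")
proof (intro equalityI subsetI)
  let ?k = "(Rdist K x - \<alpha>) / Rdist K x"
  have R: "Rdist K x > 0" using assms by simp
  have k: "?k > 0" using assms R by simp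
  note Ro = Rdist_offset[OF assms]
  { fix z assume "z \<in> ?f ` Theta K x"
    then obtain y where y: "y \<in> K" "dist x y = Rdist K x" and z: "z = ?f y" by (auto simp: Theta_def)
    have "z - y = (\<alpha> / Rdist K x) *\<^sub>R (x - y)" using R
      by (simp add: z diff_divide_distrib algebra_simps)
    then have "dist z y = \<alpha>" using R y assms(3) by (simp add: dist_norm)
    then have "z \<in> offset K \<alpha>" using y(1) by (auto simp: offset_def intro: infdist_le2)
    moreover have "dist x z = Rdist K x - \<alpha>" using R y assms(4) z by (simp add: dist_norm norm_minus_commute)
    ultimately show "z \<in> Theta (offset K \<alpha>) x" by (simp add: Theta_def Ro) }
  { fix z assume z: "z \<in> Theta (offset K \<alpha>) x"
    then have zd: "dist x z = Rdist K x - \<alpha>" and zo: "Rdist K z \<le> \<alpha>"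
      using Ro by (auto simp: Theta_def offset_def Rdist_def)
    obtain y where y: "y \<in> K" "dist z y = Rdist K z" using Theta_nonempty[OF assms(1,2), of z] by (auto simp: Theta_def)
    have le: "Rdist K x \<le> dist x y" using y by (simp add: Rdist_def infdist_le)
    have xy: "dist x y = Rdist K x" "dist z y = \<alpha>"
      using le dist_triangle[of x y z] zd zo y by linarith+
    \<comment> \<open>Equality in the triangle inequality forces \<open>z\<close> onto the segment
      from \<open>x\<close> to \<open>y\<close>, which yields the homothety.\<close>
    have "dist x y = dist x z + dist z y" using xy zd by simp
    then have "norm ((x - z) + (z - y)) = norm (x - z) + norm (z - y)" by (simp add: dist_norm)
    then have "norm (x - z) *\<^sub>R (z - y) = norm (z - y) *\<^sub>R (x - z)"
      by (simp only: norm_triangle_eq)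
    then have "(Rdist K x - \<alpha>) *\<^sub>R (z - y) = \<alpha> *\<^sub>R (x - z)"
      using xy zd by (simp add: dist_norm)
    then have "Rdist K x *\<^sub>R (z - x) = (Rdist K x - \<alpha>) *\<^sub>R (y - x)"
      by (simp add: algebra_simps)
    then have "(1 / Rdist K x) *\<^sub>R (Rdist K x *\<^sub>R (z - x)) = (1 / Rdist K x) *\<^sub>R ((Rdist K x - \<alpha>) *\<^sub>R (y - x))" by simp
    then have "z - x = ?k *\<^sub>R (y - x)" using R by simp
    then have "z = ?f y" by (simp add: algebra_simps)
    then show "z \<in> ?f ` Theta K x" using y xy by (auto simp: Theta_def) }
qed

lemma enc_radius_homothety:
  fixes S :: "'a::euclidean_space set"
  assumes "0 < k" "bounded S" "S \<noteq> {}"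
  shows "enc_radius ((\<lambda>y. x + k *\<^sub>R (y - x)) ` S) = k * enc_radius S"
proof -
  let ?f = "\<lambda>y. x + k *\<^sub>R (y - x)"
  let ?P = "\<lambda>S. {r. \<exists>c. S \<subseteq> cball c r}"
  have inv: "dist (?f a) (?f b) = k * dist a b" for a b
    using assms(1) by (simp add: dist_norm flip: scaleR_diff_right)
  have "?P (?f ` S) = (\<lambda>r. k * r) ` ?P S"
  proof (intro equalityI subsetI)
    fix r assume "r \<in> ?P (?f ` S)"
    then obtain c where c: "?f ` S \<subseteq> cball c r" by blast
    let ?d = "x + (1/k) *\<^sub>R (c - x)"
    have d: "c = ?f ?d" using assms(1) by simp
    have "k * dist ?d y \<le> r" if "y \<in> S" for y
      using c that unfolding inv[of ?d y, symmetric] d[symmetric] by auto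
    then have "S \<subseteq> cball ?d (r / k)"
      using assms(1) by (auto simp: pos_le_divide_eq mult.commute)
    then show "r \<in> (\<lambda>r. k * r) ` ?P S" using assms(1) by (intro image_eqI[of _ _ "r / k"]) auto
  next
    fix r assume "r \<in> (\<lambda>r. k * r) ` ?P S"
    then obtain c r' where "r = k * r'" "S \<subseteq> cball c r'" by blast
    then have "?f ` S \<subseteq> cball (?f c) r" using assms(1) inv by (auto simp: image_subset_iff simp del: dist_add_cancel)
    then show "r \<in> ?P (?f ` S)" by blast
  qed
  moreover have "Inf ((\<lambda>r. k * r) ` ?P S) = k * Inf (?P S)"
  proof (rule continuous_at_Inf_mono[symmetric])
    show "mono (\<lambda>r. k * r)" using assms(1) by (auto intro: monoI)
    show "continuous (at_right (Inf (?P S))) (\<lambda>r. k * r)" by (intro continuous_intros)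
    show "?P S \<noteq> {}" using assms(2) unfolding bounded_def by (auto simp: subset_eq)
    obtain v where "v \<in> S" using assms(3) by blast
    then have "0 \<le> r" if "S \<subseteq> cball c r" for c r using that by (meson mem_cball order_trans subsetD zero_le_dist)
    then show "bdd_below (?P S)" by (auto intro!: bdd_belowI[of _ 0])
  qed
  ultimately show ?thesis by (simp add: enc_radius_def)
qed

lemma FK_offset:
  assumes "closed K" "K \<noteq> {}" "0 \<le> \<alpha>" "\<alpha> < Rdist K x"
  shows "FK (offset K \<alpha>) x = (Rdist K x - \<alpha>) / Rdist K x * FK K x"
  unfolding FK_def Theta_offset[OF assms]
  by (rule enc_radius_homothety)
    (use assms in \<open>auto simp: Theta_nonempty compact_Theta compact_imp_bounded\<close>)

lemma FK_eq_0_on: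
  assumes "x \<in> L"
  shows "FK L x = 0"
proof -
  have "Theta L x = {x}" using assms by (auto simp: Theta_def Rdist_def)
  moreover have "{r. \<exists>c. {x} \<subseteq> cball c r} = {0..}"
    by (auto intro: order_trans[OF zero_le_dist] exI[of _ x])
  ultimately show ?thesis by (simp add: FK_def enc_radius_def)
qed

text \<open>Passing to the offset scales the enclosing radius by
  \<open>(Rdist K x - \<alpha>) / Rdist K x\<close>. Points of the offset itself drop out, as their
  radius is 0 and \<open>lam\<close> is positive.\<close>

lemma mem_medial_axis_iff:
  assumes "closed K" "K \<noteq> {}" "0 \<le> \<alpha>" "0 < lam"
  shows "x \<in> medial_axis lam \<alpha> K \<longleftrightarrow> \<alpha> < Rdist K x \<and> lam * Rdist K x \<le> (Rdist K x - \<alpha>) * FK K x"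
proof (cases "\<alpha> < Rdist K x")
  case True
  then show ?thesis using assms by (simp add: medial_axis_def FK_offset field_simps)
next
  case False
  then have "x \<in> offset K \<alpha>" by (simp add: offset_def Rdist_def)
  with False assms(4) show ?thesis by (simp add: medial_axis_def FK_eq_0_on)
qed

section \<open>Implicit steps of the gradient flow\<close>

text \<open>Where \<open>Rdist K y\<close> is positive, this is the generalized gradient of the
  distance function: the hull of the unit vectors pointing to \<open>y\<close> from its nearest
  points, written without a division.\<close>

definition supergrad :: "'a::euclidean_space set \<Rightarrow> 'a \<Rightarrow> 'a set" where
  "supergrad K y = {p. y - Rdist K y *\<^sub>R p \<in> convex hull Theta K y}"

lemma norm_supergrad_le_1:
  assumes "p \<in> supergrad K y" "0 < Rdist K y"
  shows "norm p \<le> 1"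
proof -
  have "dist y (y - Rdist K y *\<^sub>R p) \<le> Rdist K y"
    using assms(1) hull_Theta_subset_cball[of K y] by (auto simp: supergrad_def)
  then show ?thesis using assms(2) by (simp add: dist_norm)
qed

text \<open>The hull bound controls the square of \<open>Rdist K z\<close>; the inequality between
  arithmetic and geometric mean removes the square. The result is semiconcavity with constant
  \<open>1 / Rdist K y\<close>.\<close>

lemma Rdist_le_supergrad:
  assumes "p \<in> supergrad K y" "0 < Rdist K y"
  shows "Rdist K z \<le> Rdist K y + p \<bullet> (z - y) + (dist z y)\<^sup>2 / (2 * Rdist K y)"
proof -
  let ?r = "Rdist K y"
  have "(Rdist K z)\<^sup>2 \<le> (dist z (y - ?r *\<^sub>R p))\<^sup>2 + ?r\<^sup>2 - (dist y (y - ?r *\<^sub>R p))\<^sup>2"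
    using assms(1) by (intro Rdist_le_hull_Theta) (simp add: supergrad_def)
  also have "(dist z (y - ?r *\<^sub>R p))\<^sup>2 = (dist z y)\<^sup>2 + 2 * ?r * (p \<bullet> (z - y)) + ?r\<^sup>2 * (p \<bullet> p)"
    unfolding dist_norm power2_norm_eq_inner
    by (simp add: algebra_simps inner_commute power2_eq_square)
  also have "(dist y (y - ?r *\<^sub>R p))\<^sup>2 = ?r\<^sup>2 * (p \<bullet> p)"
    by (simp add: dist_norm power_mult_distrib power2_norm_eq_inner)
  finally have 1: "(Rdist K z)\<^sup>2 \<le> (dist z y)\<^sup>2 + 2 * ?r * (p \<bullet> (z - y)) + ?r\<^sup>2" by simp
  have "0 \<le> (Rdist K z - ?r)\<^sup>2" by simp
  then have "2 * ?r * Rdist K z \<le> (Rdist K z)\<^sup>2 + ?r\<^sup>2" by (simp add: power2_diff mult_ac)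
  with 1 have "2 * ?r * Rdist K z \<le> (dist z y)\<^sup>2 + 2 * ?r * (p \<bullet> (z - y)) + 2 * ?r\<^sup>2" by simp
  also have "\<dots> = 2 * ?r * (?r + p \<bullet> (z - y) + (dist z y)\<^sup>2 / (2 * ?r))"
    using assms(2) by (simp add: field_simps power2_eq_square)
  finally show ?thesis using assms(2) by simp
qed

text \<open>Sum of the semiconcavity bounds at \<open>y\<close> and at \<open>z\<close>, each
  evaluated at the other point.\<close>

lemma supergrad_one_sided_Lipschitz:
  assumes "p \<in> supergrad K y" "q \<in> supergrad K z" "0 < \<alpha>" "\<alpha> \<le> Rdist K y" "\<alpha> \<le> Rdist K z"
  shows "(p - q) \<bullet> (y - z) \<le> (dist y z)\<^sup>2 / \<alpha>"
proof -
  have "(dist y z)\<^sup>2 / (2 * Rdist K y) \<le> (dist y z)\<^sup>2 / (2 * \<alpha>)"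
    "(dist y z)\<^sup>2 / (2 * Rdist K z) \<le> (dist y z)\<^sup>2 / (2 * \<alpha>)"
    using assms by (auto intro!: divide_left_mono mult_pos_pos)
  moreover have "Rdist K z \<le> Rdist K y + p \<bullet> (z - y) + (dist y z)\<^sup>2 / (2 * Rdist K y)"
    using Rdist_le_supergrad[OF assms(1), of z] assms by (simp add: dist_commute)
  moreover have "Rdist K y \<le> Rdist K z + q \<bullet> (y - z) + (dist y z)\<^sup>2 / (2 * Rdist K z)"
    using Rdist_le_supergrad[OF assms(2), of y] assms by simp
  moreover have "(p - q) \<bullet> (y - z) = - (p \<bullet> (z - y)) - q \<bullet> (y - z)" by (simp add: algebra_simps)
  moreover have "(dist y z)\<^sup>2 / \<alpha> = (dist y z)\<^sup>2 / (2 * \<alpha>) + (dist y z)\<^sup>2 / (2 * \<alpha>)" by simp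
  ultimately show ?thesis by linarith
qed

text \<open>Danskin's argument: nearest points of \<open>y + t u\<close> accumulate at \<open>Theta K y\<close> as \<open>t\<close> tends to 0,
  so that a hyperplane separating \<open>w\<close> from the hull would yield a direction contradicting the
  growth bound.\<close>

lemma supergradI:
  fixes K :: "'a::euclidean_space set"
  assumes K: "closed K" "K \<noteq> {}"
    and bound: "\<And>z. Rdist K z \<le> Rdist K y + p \<bullet> (z - y) + B * (dist z y)\<^sup>2"
  shows "p \<in> supergrad K y"
proof (rule ccontr)
  define w where "w = y - Rdist K y *\<^sub>R p"
  assume "p \<notin> supergrad K y"
  then have "w \<notin> convex hull Theta K y" by (simp add: supergrad_def w_def)
  moreover have "closed (convex hull Theta K y)"
    using K by (simp add: compact_Theta compact_convex_hull compact_imp_closed)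
  ultimately obtain u b where u: "u \<bullet> w < b" "\<And>v. v \<in> convex hull Theta K y \<Longrightarrow> b < u \<bullet> v"
    using separating_hyperplane_closed_point[of "convex hull Theta K y" w] by (auto simp: convex_convex_hull)
  define t where "t n = inverse (real (Suc n))" for n
  have t: "t n > 0" for n by (simp add: t_def)
  have t0: "t \<longlonglongrightarrow> 0" unfolding t_def by (rule LIMSEQ_inverse_real_of_nat)
  \<comment> \<open>The points move against \<open>u\<close> because the hull lies beyond
    \<open>w\<close> in the direction \<open>u\<close>.\<close>
  define Y where "Y n = y - t n *\<^sub>R u" for n
  have "\<exists>v. v \<in> Theta K (Y n)" for n using Theta_nonempty[OF K] by blast
  then obtain v where v: "v n \<in> Theta K (Y n)" for n by metis
  have Y: "Y \<longlonglongrightarrow> y"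
    unfolding Y_def using tendsto_diff[OF tendsto_const tendsto_scaleR[OF t0 tendsto_const], of y u] by simp
  have RY: "(\<lambda>n. Rdist K (Y n)) \<longlonglongrightarrow> Rdist K y"
    using continuous_on_Rdist[of UNIV K] Y by (simp add: continuous_on_eq_continuous_at isCont_tendsto_compose)
  have "bounded (range v)"
  proof -
    obtain c where c: "\<And>n. norm (Rdist K (Y n)) \<le> c"
      using convergent_imp_Bseq[OF convergentI[OF RY]] by (auto simp: Bseq_def)
    obtain d where d: "\<And>n. norm (Y n) \<le> d"
      using convergent_imp_Bseq[OF convergentI[OF Y]] by (auto simp: Bseq_def)
    have "norm (v n) \<le> d + c" for n
    proof -
      have "norm (v n) \<le> norm (Y n) + dist (Y n) (v n)"
        by (metis dist_norm norm_triangle_sub dist_commute)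
      moreover have "dist (Y n) (v n) = Rdist K (Y n)" using v by (simp add: Theta_def)
      ultimately show ?thesis using c[of n] d[of n] by (simp add: abs_le_iff)
    qed
    then show ?thesis by (auto intro: boundedI)
  qed
  then obtain l r where r: "strict_mono (r::nat\<Rightarrow>nat)" and l: "(v \<circ> r) \<longlonglongrightarrow> l"
    using bounded_imp_convergent_subsequence by blast
  have "l \<in> K"
    by (rule closed_sequentially[OF K(1) _ l]) (use v in \<open>auto simp: Theta_def\<close>)
  moreover have "dist y l = Rdist K y"
  proof (rule LIMSEQ_unique)
    show "(\<lambda>n. dist (Y (r n)) (v (r n))) \<longlonglongrightarrow> dist y l"
      using tendsto_dist[OF LIMSEQ_subseq_LIMSEQ[OF Y r] l] by (simp add: o_def)
    have "dist (Y (r n)) (v (r n)) = Rdist K (Y (r n))" for n using v by (simp add: Theta_def)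
    then show "(\<lambda>n. dist (Y (r n)) (v (r n))) \<longlonglongrightarrow> Rdist K y"
      using LIMSEQ_subseq_LIMSEQ[OF RY r] by (simp add: o_def)
  qed
  ultimately have "l \<in> Theta K y" by (simp add: Theta_def)
  then have "b < u \<bullet> l" by (intro u hull_inc)
  \<comment> \<open>The nearest point of \<open>Y n\<close> limits the drop of the distance from
    \<open>y\<close> to \<open>Y n\<close>, while \<open>bound\<close> forces a drop of about
    \<open>t n * (p \<bullet> u)\<close>; the common factor \<open>t n\<close> cancels.\<close>
  have step: "(p \<bullet> u - B * t n * (norm u)\<^sup>2) * (Rdist K y + Rdist K (Y n)) \<le> 2 * (u \<bullet> (y - v n))" for n
  proof -
    have "(Rdist K y)\<^sup>2 \<le> (dist y (v n))\<^sup>2"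
      using v[of n] by (intro power_mono Rdist_nonneg) (simp add: Theta_def Rdist_def infdist_le)
    also have "\<dots> = (dist (Y n) (v n))\<^sup>2 + 2 * t n * (u \<bullet> (y - v n)) - (t n)\<^sup>2 * (norm u)\<^sup>2"
      unfolding dist_norm power2_norm_eq_inner Y_def
      by (simp add: algebra_simps inner_commute power2_eq_square)
    also have "\<dots> \<le> (Rdist K (Y n))\<^sup>2 + 2 * t n * (u \<bullet> (y - v n))"
      using v[of n] by (simp add: Theta_def)
    finally have 1: "(Rdist K y - Rdist K (Y n)) * (Rdist K y + Rdist K (Y n)) \<le> 2 * t n * (u \<bullet> (y - v n))"
      by (simp add: algebra_simps power2_eq_square)
    have "Rdist K (Y n) \<le> Rdist K y - t n * (p \<bullet> u) + B * (t n)\<^sup>2 * (norm u)\<^sup>2"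
      using bound[of "Y n"] by (simp add: Y_def dist_norm power_mult_distrib)
    then have "t n * (p \<bullet> u - B * t n * (norm u)\<^sup>2) \<le> Rdist K y - Rdist K (Y n)"
      by (simp add: algebra_simps power2_eq_square)
    then have "t n * (p \<bullet> u - B * t n * (norm u)\<^sup>2) * (Rdist K y + Rdist K (Y n))
        \<le> (Rdist K y - Rdist K (Y n)) * (Rdist K y + Rdist K (Y n))"
      by (rule mult_right_mono) (simp add: Rdist_nonneg)
    also note 1
    finally have "t n * ((p \<bullet> u - B * t n * (norm u)\<^sup>2) * (Rdist K y + Rdist K (Y n)))
        \<le> t n * (2 * (u \<bullet> (y - v n)))" by (simp only: mult_ac)
    then show ?thesis by (rule mult_left_le_imp_le) (rule t)
  qed
  \<comment> \<open>In the limit the quadratic error vanishes, and what is left puts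
    \<open>l\<close> on the same side of the hyperplane as \<open>w\<close>.\<close>
  have "(p \<bullet> u - B * 0 * (norm u)\<^sup>2) * (Rdist K y + Rdist K y) \<le> 2 * (u \<bullet> (y - l))"
  proof (rule LIMSEQ_le)
    note tr = LIMSEQ_subseq_LIMSEQ[OF t0 r, unfolded o_def]
      and Rr = LIMSEQ_subseq_LIMSEQ[OF RY r, unfolded o_def]
    show "(\<lambda>n. (p \<bullet> u - B * t (r n) * (norm u)\<^sup>2) * (Rdist K y + Rdist K (Y (r n))))
      \<longlonglongrightarrow> (p \<bullet> u - B * 0 * (norm u)\<^sup>2) * (Rdist K y + Rdist K y)"
      by (intro tendsto_intros tr Rr)
    show "(\<lambda>n. 2 * (u \<bullet> (y - v (r n)))) \<longlonglongrightarrow> 2 * (u \<bullet> (y - l))"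
      using l by (intro tendsto_intros) (simp add: o_def)
  qed (use step in blast)
  then have "u \<bullet> l \<le> u \<bullet> w"
    by (simp add: w_def inner_diff_right inner_commute mult_ac)
  then show False using u(1) \<open>b < u \<bullet> l\<close> by simp
qed

section \<open>One implicit step: existence, Lipschitz constant and monotonicity\<close>

locale prox_flow =
  fixes K :: "'a::euclidean_space set" and \<alpha> :: real
  assumes closed: "closed K" and nonempty: "K \<noteq> {}" and \<alpha>_pos: "0 < \<alpha>"
begin

abbreviation R :: "'a \<Rightarrow> real" where "R \<equiv> Rdist K"

text \<open>The supergradient is taken at the arrival point \<open>y\<close>, and
  \<open>\<alpha> < R y\<close> keeps that point where semiconcavity holds with constant
  \<open>1 / \<alpha>\<close>.\<close>

definition is_prox :: "real \<Rightarrow> 'a \<Rightarrow> 'a \<Rightarrow> bool" where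
  "is_prox h x y \<longleftrightarrow> \<alpha> < R y \<and> (\<exists>p \<in> supergrad K y. y = x + h *\<^sub>R p)"

definition prox :: "real \<Rightarrow> 'a \<Rightarrow> 'a" where
  "prox h x = (SOME y. is_prox h x y)"

lemma is_proxE:
  assumes "is_prox h x y"
  obtains p where "\<alpha> < R y" "p \<in> supergrad K y" "y = x + h *\<^sub>R p" "norm p \<le> 1"
  using assms norm_supergrad_le_1[of _ K y] \<alpha>_pos by (auto simp: is_prox_def)

text \<open>A maximizer \<open>y\<close> of \<open>R y - (dist y x)\<^sup>2 / (2 * h)\<close> is a
  valid step: optimality is the growth bound that makes \<open>(y - x) / h\<close> a
  supergradient.\<close>

lemma is_prox_exists:
  assumes x: "\<alpha> < R x" and h: "0 \<le> h"
  shows "\<exists>y. is_prox h x y"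
proof (cases "h = 0")
  case True
  have "(1 / R x) *\<^sub>R (x - foot K x) \<in> supergrad K x"
    using x \<alpha>_pos foot_in_hull[OF closed nonempty, of x] by (simp add: supergrad_def)
  then show ?thesis using True x by (auto simp: is_prox_def)
next
  case False
  then have h: "h > 0" using assms by simp
  define g where "g y = R y - (dist y x)\<^sup>2 / (2 * h)" for y
  \<comment> \<open>\<open>R\<close> is 1-Lipschitz, so beyond distance \<open>2 * h\<close> the
    quadratic penalty outweighs any gain and a maximizer on this ball is global.\<close>
  have "\<exists>y\<in>cball x (2 * h). \<forall>z\<in>cball x (2 * h). g z \<le> g y"
    unfolding g_def
    by (rule continuous_attains_sup) (use h in \<open>auto intro!: continuous_intros continuous_on_Rdist\<close>)
  then obtain y where y: "y \<in> cball x (2 * h)" "\<And>z. z \<in> cball x (2 * h) \<Longrightarrow> g z \<le> g y" by blast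
  have gx: "R x \<le> g y" using y(2)[of x] h by (simp add: g_def)
  have max: "g z \<le> g y" for z
  proof (cases "z \<in> cball x (2 * h)")
    case False
    then have "2 * h \<le> dist z x" by (simp add: dist_commute)
    then have "dist z x * (2 * h) \<le> dist z x * dist z x" by (intro mult_left_mono) auto
    then have "dist z x \<le> (dist z x)\<^sup>2 / (2 * h)" using h by (simp add: field_simps power2_eq_square)
    then show ?thesis using gx Rdist_triangle[of K z x] by (simp add: g_def)
  qed (use y in blast)
  have "0 \<le> (dist y x)\<^sup>2 / (2 * h)" using h by simp
  then have Ry: "\<alpha> < R y" using gx x unfolding g_def by linarith
  define p where "p = (1 / h) *\<^sub>R (y - x)"
  have pi: "p \<bullet> v = ((y - x) \<bullet> v) / h" for v by (simp add: p_def)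
  have "p \<in> supergrad K y"
  proof (rule supergradI[OF closed nonempty])
    fix z
    have "(dist z x)\<^sup>2 = (dist y x)\<^sup>2 + 2 * ((y - x) \<bullet> (z - y)) + (dist z y)\<^sup>2"
      unfolding dist_norm power2_norm_eq_inner by (simp add: algebra_simps inner_commute)
    then have "(dist z x)\<^sup>2 / (2 * h) = (dist y x)\<^sup>2 / (2 * h) + p \<bullet> (z - y) + (1 / (2 * h)) * (dist z y)\<^sup>2"
      using h by (simp add: pi add_divide_distrib)
    then show "R z \<le> R y + p \<bullet> (z - y) + (1 / (2 * h)) * (dist z y)\<^sup>2"
      using max[of z] by (simp add: g_def)
  qed
  moreover have "y = x + h *\<^sub>R p" using h by (simp add: p_def)
  ultimately show ?thesis using Ry by (auto simp: is_prox_def)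
qed

lemma is_prox_prox: "\<alpha> < R x \<Longrightarrow> 0 \<le> h \<Longrightarrow> is_prox h x (prox h x)"
  unfolding prox_def by (rule someI_ex) (rule is_prox_exists)

text \<open>The difference of the two step equations is tested against \<open>y - y'\<close>. The
  gradient part is at most \<open>h / \<alpha>\<close> times the squared distance and is absorbed on
  the left.\<close>

lemma is_prox_Lipschitz:
  assumes "is_prox h x y" "is_prox h x' y'" "0 \<le> h" "h < \<alpha>"
  shows "dist y y' \<le> dist x x' / (1 - h / \<alpha>)"
proof -
  obtain p where p: "\<alpha> < R y" "p \<in> supergrad K y" "y = x + h *\<^sub>R p" using assms(1) by (rule is_proxE)
  obtain p' where p': "\<alpha> < R y'" "p' \<in> supergrad K y'" "y' = x' + h *\<^sub>R p'" using assms(2) by (rule is_proxE)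
  have "(p - p') \<bullet> (y - y') \<le> (dist y y')\<^sup>2 / \<alpha>"
    by (rule supergrad_one_sided_Lipschitz) (use p p' \<alpha>_pos in auto)
  then have 1: "h * ((p - p') \<bullet> (y - y')) \<le> h * ((dist y y')\<^sup>2 / \<alpha>)"
    by (rule mult_left_mono) (rule assms)
  have "(x - x') \<bullet> (y - y') \<le> norm (x - x') * norm (y - y')"
    by (rule norm_cauchy_schwarz)
  then have 2: "(x - x') \<bullet> (y - y') \<le> dist x x' * dist y y'" by (simp add: dist_norm)
  have "(dist y y')\<^sup>2 = (y - y') \<bullet> (y - y')" by (simp add: dist_norm power2_norm_eq_inner)
  also have "\<dots> = ((x - x') + h *\<^sub>R (p - p')) \<bullet> (y - y')"
    by (subst (1) p(3), subst (1) p'(3)) (simp add: algebra_simps)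
  also have "\<dots> = (x - x') \<bullet> (y - y') + h * ((p - p') \<bullet> (y - y'))"
    by (simp add: inner_add_left)
  finally have "(dist y y')\<^sup>2 \<le> dist x x' * dist y y' + h * ((dist y y')\<^sup>2 / \<alpha>)"
    using 1 2 by linarith
  then have "(dist y y' * (1 - h / \<alpha>)) * dist y y' \<le> dist x x' * dist y y'"
    by (simp add: algebra_simps power2_eq_square)
  then have "dist y y' * (1 - h / \<alpha>) \<le> dist x x' \<or> dist y y' = 0"
    by (metis mult_right_le_imp_le zero_less_dist_iff dist_eq_0_iff)
  moreover have "0 < 1 - h / \<alpha>" using assms \<alpha>_pos by simp
  ultimately show ?thesis by (auto simp: pos_le_divide_eq)
qed

text \<open>The hull bound at the arrival point is evaluated at the starting point, which differs
  from \<open>y - R y *\<^sub>R p\<close> by a multiple of \<open>p\<close>.\<close>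

lemma Rdist_prox_step:
  assumes "y = x + h *\<^sub>R p" "p \<in> supergrad K y"
  shows "(R x)\<^sup>2 \<le> (R y)\<^sup>2 - h * (2 * R y - h) * (norm p)\<^sup>2"
proof -
  have w: "y - R y *\<^sub>R p \<in> convex hull Theta K y" using assms by (simp add: supergrad_def)
  have "x - (y - R y *\<^sub>R p) = (R y - h) *\<^sub>R p" by (simp add: assms(1) algebra_simps)
  then have "dist x (y - R y *\<^sub>R p) = \<bar>R y - h\<bar> * norm p" by (simp add: dist_norm)
  moreover have "dist y (y - R y *\<^sub>R p) = R y * norm p" by (simp add: dist_norm Rdist_nonneg)
  ultimately show ?thesis
    using Rdist_le_hull_Theta[OF w, of x] by (simp add: power_mult_distrib algebra_simps power2_eq_square)
qed

text \<open>The foot is the point of the hull closest to \<open>y\<close>, hence at distance at most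
  \<open>R y * norm p\<close>.\<close>

lemma FK_ge_supergrad:
  assumes "p \<in> supergrad K y"
  shows "(R y)\<^sup>2 * (1 - (norm p)\<^sup>2) \<le> (FK K y)\<^sup>2"
proof -
  have "y - R y *\<^sub>R p \<in> convex hull Theta K y" using assms by (simp add: supergrad_def)
  from foot_le[OF closed this] have "(dist y (foot K y))\<^sup>2 \<le> (R y * norm p)\<^sup>2"
    by (intro power_mono) (simp_all add: dist_norm Rdist_nonneg)
  then show ?thesis by (simp add: FK_power2[OF closed nonempty] power_mult_distrib algebra_simps)
qed

lemma norm_gradK_le_supergrad:
  assumes "p \<in> supergrad K y" "0 < R y"
  shows "norm (gradK K y) \<le> norm p"
proof -
  have "y - R y *\<^sub>R p \<in> convex hull Theta K y" using assms by (simp add: supergrad_def)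
  from foot_le[OF closed this] have "dist y (foot K y) \<le> R y * norm p"
    by (simp add: dist_norm Rdist_nonneg)
  then show ?thesis using assms(2) by (simp add: norm_gradK[OF closed nonempty] field_simps)
qed

text \<open>Each implicit step enlarges \<open>FK\<close> exactly, not merely up to an error in \<open>h\<close>; this is why
  implicit steps can replace the gradient flow.\<close>

lemma FK_prox_mono:
  assumes "is_prox h x y" "0 \<le> h" "h \<le> \<alpha>"
  shows "FK K x \<le> FK K y"
proof (cases "y = x")
  case False
  obtain p where p: "\<alpha> < R y" "p \<in> supergrad K y" "y = x + h *\<^sub>R p" using assms(1) by (rule is_proxE)
  have hp: "h > 0" "p \<noteq> 0" using p(3) False assms(2) by auto
  define w where "w = y - R y *\<^sub>R p"
  define c where "c = foot K x"
  have w: "w \<in> convex hull Theta K y" using p by (simp add: supergrad_def w_def)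
  have c: "c \<in> convex hull Theta K x" unfolding c_def by (rule foot_in_hull[OF closed nonempty])
  note 1 = Rdist_le_hull_Theta[OF w, of x] and 2 = Rdist_le_hull_Theta[OF c, of y]
  \<comment> \<open>The bound based at \<open>y\<close> and evaluated at \<open>x\<close> is added
    to the one based at \<open>x\<close> and evaluated at \<open>y\<close>; the radii
    cancel.\<close>
  have "(y - x) \<bullet> (c - w) \<le> 0"
  proof -
    have "(dist y w)\<^sup>2 - (dist x w)\<^sup>2 \<le> (dist y c)\<^sup>2 - (dist x c)\<^sup>2" using 1 2 by linarith
    then show ?thesis unfolding dist_norm power2_norm_eq_inner by (simp add: algebra_simps inner_commute)
  qed
  then have "h * (p \<bullet> (c - w)) \<le> 0" using p(3) by simp
  then have "p \<bullet> (c - w) \<le> 0" using hp by (simp add: mult_le_0_iff)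
  moreover have xw: "x - w = (R y - h) *\<^sub>R p" by (simp add: w_def p(3) algebra_simps)
  then have "(R y - h) * (norm p)\<^sup>2 = p \<bullet> (x - w)" by (simp add: power2_norm_eq_inner)
  moreover have "p \<bullet> (x - w) = p \<bullet> (x - c) + p \<bullet> (c - w)" by (simp add: inner_diff_right)
  ultimately have "(R y - h) * (norm p)\<^sup>2 \<le> p \<bullet> (x - c)" by linarith
  also have "\<dots> \<le> norm p * dist x c" by (simp add: dist_norm norm_cauchy_schwarz)
  finally have "norm p * ((R y - h) * norm p) \<le> norm p * dist x c"
    by (simp add: power2_eq_square mult_ac)
  then have "(R y - h) * norm p \<le> dist x c" using hp by simp
  \<comment> \<open>By \<open>h \<le> \<alpha> < R y\<close> the factor \<open>R y - h\<close> is
    positive, so the left-hand side is the exact length of \<open>x - w\<close>.\<close>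
  then have le: "dist x w \<le> dist x c" using xw p(1) assms(3) by (simp add: dist_norm)
  have "(FK K x)\<^sup>2 = (R x)\<^sup>2 - (dist x c)\<^sup>2" by (simp add: FK_power2[OF closed nonempty] c_def)
  also have "\<dots> \<le> (R y)\<^sup>2 - (dist y w)\<^sup>2"
    using 1 power_mono[OF le zero_le_dist, of 2] by linarith
  also have "\<dots> \<le> (FK K y)\<^sup>2"
    using FK_ge_supergrad[OF p(2)] by (simp add: w_def dist_norm Rdist_nonneg power_mult_distrib algebra_simps)
  finally show ?thesis by (rule power2_le_imp_le) (rule FK_nonneg[OF closed nonempty])
qed simp

lemma Rdist_prox_mono:
  assumes "is_prox h x y" "0 \<le> h" "h \<le> \<alpha>"
  shows "R x \<le> R y"
proof -
  obtain p where p: "\<alpha> < R y" "p \<in> supergrad K y" "y = x + h *\<^sub>R p" using assms(1) by (rule is_proxE)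
  have "0 \<le> h * (2 * R y - h) * (norm p)\<^sup>2" using p(1) assms(2,3) by simp
  then have "(R x)\<^sup>2 \<le> (R y)\<^sup>2" using Rdist_prox_step[OF p(3,2)] by linarith
  then show ?thesis by (rule power2_le_imp_le) (rule Rdist_nonneg)
qed

end

section \<open>Time needed to enter the medial axis\<close>

text \<open>A point at distance \<open>r\<close> from \<open>K\<close> lies in the medial axis iff \<open>FK K\<close> is at least
  \<open>lam * r / (r - \<alpha>)\<close> there. This threshold decreases in \<open>r\<close>; the lemma quantifies by how much it
  drops along a trajectory of duration \<open>T\<close>.\<close>

lemma critical_radius_gap:
  fixes \<alpha> lam mt \<delta> Rm R0 r1 T :: real
  assumes pos: "0 < \<alpha>" "0 < lam" "0 < mt" "mt \<le> 1" "0 < \<delta>"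
    and R0: "\<alpha> < R0" and r1: "r1 \<le> Rm" and Rm: "\<alpha> + lam \<le> Rm"
    and growth: "mt\<^sup>2 * T / 2 \<le> r1 - R0"
    and T: "T * (sqrt \<alpha> * (sqrt mt)^3 * lam) = 22 / 3 * Rm\<^sup>2 * sqrt \<delta>"
    and \<delta>: "\<delta> < lam\<^sup>2 * \<alpha> * mt / (16 * Rm\<^sup>2)"
    and r0: "r0 = R0 + \<delta>" and m: "m = lam * r0 / (r0 - \<alpha>)" and M: "M = lam * r1 / (r1 - \<alpha>)"
  shows "r0 \<le> r1" and "4 * \<delta> * Rm\<^sup>2 < (m\<^sup>2 - M\<^sup>2 - 2 * \<delta> * r0) * T"
proof -
  \<comment> \<open>Named square roots turn the fractional powers into polynomial ones.\<close>
  define g q b where "g = sqrt \<alpha>" and "q = sqrt mt" and "b = sqrt \<delta>"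
  have g: "g > 0" "g\<^sup>2 = \<alpha>" and q: "q > 0" "q\<^sup>2 = mt" and b: "b > 0" "b\<^sup>2 = \<delta>"
    using pos by (auto simp: g_def q_def b_def)
  have Rpos: "Rm > 0" using pos Rm by simp
  have T': "T * (g * q^3 * lam) = 22 / 3 * Rm\<^sup>2 * b" using T by (simp add: g_def q_def b_def)
  have Tpos: "T > 0"
  proof -
    have "0 < T * (g * q^3 * lam)" unfolding T' using Rpos b by simp
    moreover have "0 < g * q^3 * lam" using g q pos by simp
    ultimately show ?thesis by (simp only: zero_less_mult_pos2)
  qed
  have "(4 * Rm * b)\<^sup>2 < (lam * g * q)\<^sup>2"
    using \<delta> Rpos by (simp add: power_mult_distrib g q b field_simps)
  then have small: "4 * Rm * b < lam * g * q"
    by (rule power2_less_imp_less) (use g q pos in simp)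
  have lamR: "lam\<^sup>2 * \<alpha> \<le> Rm^3"
  proof -
    have "lam\<^sup>2 * \<alpha> \<le> Rm\<^sup>2 * Rm" using pos Rm by (intro mult_mono power_mono) auto
    then show ?thesis by (simp add: power3_eq_cube power2_eq_square)
  qed
  have Tub: "T * mt \<le> 22 / 12 * Rm"
  proof -
    have "T * mt * (g * q * lam) = T * (g * q^3 * lam)"
      by (simp add: q(2)[symmetric] power3_eq_cube power2_eq_square)
    also have "\<dots> = (22 / 12 * Rm) * (4 * Rm * b)" by (simp add: T' power2_eq_square)
    also have "\<dots> \<le> (22 / 12 * Rm) * (lam * g * q)" using small Rpos by (intro mult_left_mono) auto
    finally have "T * mt * (g * q * lam) \<le> (22 / 12 * Rm) * (g * q * lam)" by (simp add: mult_ac)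
    then show ?thesis using g q pos by (simp add: mult_le_cancel_right)
  qed
  have T2: "lam\<^sup>2 * \<alpha> * mt^3 * T\<^sup>2 = 484 / 9 * Rm^4 * \<delta>"
  proof -
    have "lam\<^sup>2 * \<alpha> * mt^3 * T\<^sup>2 = (T * (g * q^3 * lam))\<^sup>2"
      by (simp add: g(2)[symmetric] q(2)[symmetric] power_mult_distrib power_mult[symmetric] mult_ac)
    also have "\<dots> = 484 / 9 * Rm^4 * \<delta>"
      unfolding T' by (simp add: b(2)[symmetric] power_mult_distrib power2_eq_square power4_eq_xxxx)
    finally show ?thesis .
  qed
  \<comment> \<open>This makes the guaranteed growth \<open>mt\<^sup>2 * T / 2\<close> at least
    \<open>2 * \<delta>\<close>, so that \<open>r1\<close> passes
    \<open>r0 = R0 + \<delta>\<close>.\<close>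
  have \<delta>T: "4 * \<delta> \<le> mt\<^sup>2 * T"
  proof -
    have "4 * \<delta> * (g * lam * Rm) = (4 * Rm * b) * (b * g * lam)"
      by (simp add: b(2)[symmetric] power2_eq_square)
    also have "\<dots> \<le> (lam * g * q) * (b * g * lam)"
      using small b g pos by (intro mult_right_mono) auto
    also have "\<dots> = (lam\<^sup>2 * \<alpha>) * (q * b)" by (simp add: g(2)[symmetric] power2_eq_square)
    also have "\<dots> \<le> Rm^3 * (q * b)" using lamR q b by (intro mult_right_mono) auto
    also have "\<dots> \<le> (22 / 3) * (Rm^3 * (q * b))" using Rpos q b by simp
    also have "\<dots> = q * Rm * (22 / 3 * Rm\<^sup>2 * b)" by (simp add: power3_eq_cube power2_eq_square)
    also have "\<dots> = q * Rm * (T * (g * q^3 * lam))" by (simp only: T')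
    also have "\<dots> = mt\<^sup>2 * T * (g * lam * Rm)"
      by (simp add: q(2)[symmetric] power3_eq_cube power2_eq_square)
    finally show ?thesis using g pos Rpos by (simp add: mult_le_cancel_right)
  qed
  define E where "E = r1 - r0"
  have E: "mt\<^sup>2 * T / 2 - \<delta> \<le> E" using growth by (simp add: E_def r0)
  then have E0: "0 \<le> E" using \<delta>T pos by linarith
  then show r01: "r0 \<le> r1" by (simp add: E_def)
  have r0a: "0 < r0 - \<alpha>" "0 < r1 - \<alpha>" using R0 r0 pos r01 by auto
  \<comment> \<open>The threshold equals \<open>lam + lam * \<alpha> / (r - \<alpha>)\<close> at
    radius \<open>r\<close>, so its drop has a closed form with the factor \<open>E\<close>.\<close>
  have mM: "m - M = lam * \<alpha> * E / ((r0 - \<alpha>) * (r1 - \<alpha>))"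
    using r0a unfolding m M E_def by (simp add: field_simps)
  then have mM0: "0 \<le> m - M" using pos E0 r0a by simp
  have M0: "0 \<le> M" using r0a pos by (simp add: M)
  have "2 * lam\<^sup>2 * \<alpha> * E / Rm\<^sup>2 \<le> 2 * lam\<^sup>2 * \<alpha> * E * (r1 / ((r0 - \<alpha>) * (r1 - \<alpha>)\<^sup>2))"
  proof -
    have "(r0 - \<alpha>) * (r1 - \<alpha>)\<^sup>2 \<le> r1 * Rm\<^sup>2"
      using r0a r01 pos r1 by (intro mult_mono power_mono) auto
    then have "1 / Rm\<^sup>2 \<le> r1 / ((r0 - \<alpha>) * (r1 - \<alpha>)\<^sup>2)"
      using r0a Rpos by (simp add: field_simps)
    then have "2 * lam\<^sup>2 * \<alpha> * E * (1 / Rm\<^sup>2) \<le> 2 * lam\<^sup>2 * \<alpha> * E * (r1 / ((r0 - \<alpha>) * (r1 - \<alpha>)\<^sup>2))"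
      using pos E0 by (intro mult_left_mono) auto
    then show ?thesis by simp
  qed
  also have "\<dots> = (m - M) * (2 * M)"
    unfolding mM unfolding M by (simp add: power2_eq_square mult_ac)
  also have "\<dots> \<le> (m - M) * (m + M)" using mM0 M0 by (intro mult_left_mono) auto
  also have "\<dots> = m\<^sup>2 - M\<^sup>2" by (simp add: power2_eq_square algebra_simps)
  finally have k1: "2 * lam\<^sup>2 * \<alpha> * E / Rm\<^sup>2 \<le> m\<^sup>2 - M\<^sup>2" .
  have "\<delta> * r0 \<le> \<delta> * Rm" using r01 r1 pos by (intro mult_left_mono) auto
  then have k2: "2 * lam\<^sup>2 * \<alpha> * E / Rm\<^sup>2 - 2 * \<delta> * Rm \<le> m\<^sup>2 - M\<^sup>2 - 2 * \<delta> * r0"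
    using k1 by linarith
  have "2 * lam\<^sup>2 * \<alpha> * (mt\<^sup>2 * T / 2 - \<delta>) \<le> 2 * lam\<^sup>2 * \<alpha> * E"
    using E pos by (intro mult_left_mono) auto
  moreover have "2 * \<delta> * (lam\<^sup>2 * \<alpha>) \<le> 2 * \<delta> * Rm^3" using lamR pos by (intro mult_left_mono) auto
  ultimately have "lam\<^sup>2 * \<alpha> * mt\<^sup>2 * T - 2 * \<delta> * Rm^3 \<le> 2 * lam\<^sup>2 * \<alpha> * E"
    by (simp add: algebra_simps)
  then have "lam\<^sup>2 * \<alpha> * mt\<^sup>2 * T - 4 * \<delta> * Rm^3 \<le> 2 * lam\<^sup>2 * \<alpha> * E - 2 * \<delta> * Rm^3" by simp
  also have "\<dots> = (2 * lam\<^sup>2 * \<alpha> * E / Rm\<^sup>2 - 2 * \<delta> * Rm) * Rm\<^sup>2"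
    using Rpos by (simp add: field_simps power3_eq_cube power2_eq_square)
  also have "\<dots> \<le> (m\<^sup>2 - M\<^sup>2 - 2 * \<delta> * r0) * Rm\<^sup>2" using k2 by (rule mult_right_mono) simp
  finally have k3: "lam\<^sup>2 * \<alpha> * mt\<^sup>2 * T - 4 * \<delta> * Rm^3 \<le> (m\<^sup>2 - M\<^sup>2 - 2 * \<delta> * r0) * Rm\<^sup>2" .
  \<comment> \<open>Everything is compared in multiples of \<open>\<delta> * Rm^4\<close>. The claim
    reduces to 4 < 484/9 - 22/3, where 484/9 is the square of 22/3 and the last term is 4 times
    22/12.\<close>
  have "(4 * \<delta> * Rm\<^sup>2) * (mt * Rm\<^sup>2) = 4 * (\<delta> * Rm^4) * mt"
    by (simp add: power2_eq_square power4_eq_xxxx)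
  also have "\<dots> \<le> 4 * (\<delta> * Rm^4) * 1" using pos Rpos by (intro mult_left_mono) auto
  also have "\<dots> < 484 / 9 * Rm^4 * \<delta> - 4 * \<delta> * Rm^3 * (22 / 12 * Rm)"
  proof -
    have "0 < \<delta> * Rm^4" using pos Rpos by simp
    then show ?thesis by (simp add: power3_eq_cube power4_eq_xxxx mult_ac)
  qed
  also have "\<dots> \<le> lam\<^sup>2 * \<alpha> * mt^3 * T\<^sup>2 - 4 * \<delta> * Rm^3 * (T * mt)"
    unfolding T2 using mult_left_mono[OF Tub, of "4 * \<delta> * Rm^3"] pos Rpos by simp
  also have "\<dots> = (lam\<^sup>2 * \<alpha> * mt\<^sup>2 * T - 4 * \<delta> * Rm^3) * (T * mt)"
    by (simp add: algebra_simps power3_eq_cube power2_eq_square)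
  also have "\<dots> \<le> ((m\<^sup>2 - M\<^sup>2 - 2 * \<delta> * r0) * Rm\<^sup>2) * (T * mt)"
    using k3 by (rule mult_right_mono) (use Tpos pos in simp)
  also have "\<dots> = ((m\<^sup>2 - M\<^sup>2 - 2 * \<delta> * r0) * T) * (mt * Rm\<^sup>2)" by simp
  finally show "4 * \<delta> * Rm\<^sup>2 < (m\<^sup>2 - M\<^sup>2 - 2 * \<delta> * r0) * T"
    using pos Rpos by (simp add: mult_less_cancel_right)
qed

section \<open>Iterated steps and their arrival in the medial axis\<close>

context prox_flow
begin

lemma Rdist_prox_iter:
  assumes "\<alpha> < R x" "0 \<le> h"
  shows "\<alpha> < R ((prox h ^^ n) x)"
proof (induction n)
  case (Suc n)
  then show ?case using is_prox_prox[OF Suc assms(2)] by (auto simp: is_prox_def)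
qed (use assms in simp)

lemma is_prox_iter:
  assumes "\<alpha> < R x" "0 \<le> h"
  shows "is_prox h ((prox h ^^ n) x) ((prox h ^^ Suc n) x)"
  using is_prox_prox[OF Rdist_prox_iter[OF assms] assms(2)] by simp

lemma dist_prox_iter_le:
  assumes "\<alpha> < R x" "0 \<le> h"
  shows "dist x ((prox h ^^ n) x) \<le> real n * h"
proof (induction n)
  case (Suc n)
  obtain p where "(prox h ^^ Suc n) x = (prox h ^^ n) x + h *\<^sub>R p" "norm p \<le> 1"
    using is_prox_iter[OF assms, of n] by (rule is_proxE)
  then have "dist ((prox h ^^ n) x) ((prox h ^^ Suc n) x) \<le> h"
    using assms(2) by (simp add: dist_norm mult_left_le del: funpow.simps)
  then show ?case
    using Suc dist_triangle[of x "(prox h ^^ Suc n) x" "(prox h ^^ n) x"] by (simp add: algebra_simps)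
qed simp

lemma prox_iter_Lipschitz:
  assumes "\<alpha> < R x" "\<alpha> < R y" "0 \<le> h" "h < \<alpha>"
  shows "dist ((prox h ^^ n) x) ((prox h ^^ n) y) \<le> dist x y / (1 - h / \<alpha>) ^ n"
proof (induction n)
  case (Suc n)
  have "0 < 1 - h / \<alpha>" using assms \<alpha>_pos by simp
  then have "dist ((prox h ^^ n) x) ((prox h ^^ n) y) / (1 - h / \<alpha>) \<le> dist x y / (1 - h / \<alpha>) ^ n / (1 - h / \<alpha>)"
    using Suc by (intro divide_right_mono) auto
  with is_prox_Lipschitz[OF is_prox_iter[OF assms(1,3), of n] is_prox_iter[OF assms(2,3), of n] assms(3,4)]
  show ?case by (simp add: mult.commute)
qed simp

lemma FK_prox_iter_mono:
  assumes "\<alpha> < R x" "0 \<le> h" "h \<le> \<alpha>" "k \<le> n"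
  shows "FK K ((prox h ^^ k) x) \<le> FK K ((prox h ^^ n) x)"
  using lift_Suc_mono_le[of "\<lambda>k. FK K ((prox h ^^ k) x)"]
    FK_prox_mono[OF is_prox_iter[OF assms(1,2)] assms(2,3)] assms(4) by blast

lemma Rdist_prox_iter_mono:
  assumes "\<alpha> < R x" "0 \<le> h" "h \<le> \<alpha>" "k \<le> n"
  shows "R ((prox h ^^ k) x) \<le> R ((prox h ^^ n) x)"
  using lift_Suc_mono_le[of "\<lambda>k. R ((prox h ^^ k) x)"]
    Rdist_prox_mono[OF is_prox_iter[OF assms(1,2)] assms(2,3)] assms(4) by blast

lemma medial_axis_iff:
  assumes "0 < lam"
  shows "x \<in> medial_axis lam \<alpha> K \<longleftrightarrow> \<alpha> < R x \<and> lam * R x \<le> (R x - \<alpha>) * FK K x"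
  using mem_medial_axis_iff[OF closed nonempty, of \<alpha> lam x] \<alpha>_pos assms by simp

lemma medial_axis_Rdist:
  assumes "0 < lam" "x \<in> medial_axis lam \<alpha> K"
  shows "\<alpha> + lam \<le> R x"
proof -
  have x: "\<alpha> < R x" "lam * R x \<le> (R x - \<alpha>) * FK K x" using assms medial_axis_iff by auto
  have "(R x - \<alpha>) * FK K x \<le> (R x - \<alpha>) * R x"
    using x FK_le_Rdist[OF closed nonempty, of x] by (intro mult_left_mono) auto
  with x(2) have "lam * R x \<le> (R x - \<alpha>) * R x" by linarith
  then show ?thesis using x(1) \<alpha>_pos by (simp add: mult_le_cancel_right)
qed

text \<open>A step decreases neither \<open>R\<close> nor \<open>FK K\<close>, hence neither the
  factor \<open>1 - \<alpha> / R\<close> by which the offset scales the radius.\<close>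

lemma medial_axis_prox:
  assumes "0 < lam" "is_prox h x y" "0 \<le> h" "h \<le> \<alpha>" "x \<in> medial_axis lam \<alpha> K"
  shows "y \<in> medial_axis lam \<alpha> K"
proof -
  have x: "\<alpha> < R x" "lam * R x \<le> (R x - \<alpha>) * FK K x" using assms medial_axis_iff by auto
  have R: "R x \<le> R y" and F: "FK K x \<le> FK K y"
    using Rdist_prox_mono FK_prox_mono assms by blast+
  have "lam \<le> (1 - \<alpha> / R x) * FK K x" using x \<alpha>_pos by (simp add: field_simps)
  also have "\<dots> \<le> (1 - \<alpha> / R y) * FK K y"
    using R F x \<alpha>_pos by (intro mult_mono diff_left_mono divide_left_mono) (auto simp: FK_nonneg[OF closed nonempty])
  finally show ?thesis using x R \<alpha>_pos by (simp add: medial_axis_iff[OF assms(1)] field_simps)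
qed

lemma medial_axis_prox_iter:
  assumes "0 < lam" "\<alpha> < R x" "0 \<le> h" "h \<le> \<alpha>" "k \<le> n" "(prox h ^^ k) x \<in> medial_axis lam \<alpha> K"
  shows "(prox h ^^ n) x \<in> medial_axis lam \<alpha> K"
  using assms(5)
proof (induction n rule: dec_induct)
  case (step n)
  then show ?case
    using medial_axis_prox[OF assms(1) is_prox_iter[OF assms(2,3)] assms(3,4)] by blast
qed (use assms in simp)

text \<open>Outside the axis supergradients have norm at least \<open>mt\<close>, so each step gains
  at least \<open>h * mt\<^sup>2 / 2\<close>. If the last point is outside, so are all earlier ones,
  since the axis is absorbing.\<close>

lemma prox_iter_growth:
  assumes lam: "0 < lam" and x: "\<alpha> < R x" and h: "0 \<le> h" "h \<le> \<alpha>" and mt: "0 \<le> mt"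
    and grad: "\<And>y. \<alpha> < R y \<Longrightarrow> y \<notin> medial_axis lam \<alpha> K \<Longrightarrow> mt \<le> norm (gradK K y)"
    and out: "(prox h ^^ n) x \<notin> medial_axis lam \<alpha> K"
  shows "mt\<^sup>2 * (real n * h) / 2 \<le> R ((prox h ^^ n) x) - R x"
  using out
proof (induction n)
  case (Suc n)
  let ?y = "(prox h ^^ n) x" and ?z = "(prox h ^^ Suc n) x"
  have IH: "mt\<^sup>2 * (real n * h) / 2 \<le> R ?y - R x"
    using Suc medial_axis_prox_iter[OF lam x h, of n "Suc n"] by fastforce
  obtain p where p: "\<alpha> < R ?z" "p \<in> supergrad K ?z" "?z = ?y + h *\<^sub>R p"
    using is_prox_iter[OF x h(1), of n] by (rule is_proxE)
  have "mt \<le> norm p"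
    using grad[OF p(1) Suc.prems] norm_gradK_le_supergrad[OF p(2)] p(1) \<alpha>_pos by simp
  then have "mt\<^sup>2 \<le> (norm p)\<^sup>2" using mt by (intro power_mono)
  \<comment> \<open>From \<open>h \<le> \<alpha> < R ?z\<close> follows
    \<open>R ?z \<le> 2 * R ?z - h\<close>; the factor \<open>R ?z\<close> later cancels against the
    sum of the two radii.\<close>
  then have "h * R ?z * mt\<^sup>2 \<le> h * (2 * R ?z - h) * (norm p)\<^sup>2"
    using h p(1) \<alpha>_pos by (intro mult_mono) auto
  also have "\<dots> \<le> (R ?z)\<^sup>2 - (R ?y)\<^sup>2" using Rdist_prox_step[OF p(3,2)] by simp
  also have "\<dots> = (R ?z - R ?y) * (R ?z + R ?y)" by (simp add: power2_eq_square algebra_simps)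
  also have "\<dots> \<le> (R ?z - R ?y) * (2 * R ?z)"
    using Rdist_prox_mono[OF is_prox_iter[OF x h(1), of n] h] by (intro mult_left_mono) auto
  finally have "R ?z * (h * mt\<^sup>2) \<le> R ?z * (2 * (R ?z - R ?y))" by (simp only: mult_ac)
  then have "h * mt\<^sup>2 \<le> 2 * (R ?z - R ?y)" using p(1) \<alpha>_pos by (simp add: mult_le_cancel_left)
  with IH show ?case by (simp add: algebra_simps add_divide_distrib)
qed simp

text \<open>Growth at a definite rate cannot continue past the bound \<open>Rm\<close>. This crude
  entry time serves to show that the intrinsic diameter is finite.\<close>

lemma prox_iter_enters_medial_axis:
  assumes "0 < lam" "\<alpha> < R x" "0 \<le> h" "h \<le> \<alpha>" "0 \<le> mt"
    and "\<And>y. \<alpha> < R y \<Longrightarrow> y \<notin> medial_axis lam \<alpha> K \<Longrightarrow> mt \<le> norm (gradK K y)"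
    and "\<And>z. R z \<le> Rm" "Rm \<le> mt\<^sup>2 * (real n * h) / 2"
  shows "(prox h ^^ n) x \<in> medial_axis lam \<alpha> K"
proof (rule ccontr)
  assume "\<not> ?thesis"
  from prox_iter_growth[OF assms(1-6) this] assms(7)[of "(prox h ^^ n) x"] assms(8) assms(2) \<alpha>_pos
  show False by linarith
qed

text \<open>\<open>s\<close> is the length of the polygonal trajectory. While \<open>FK K\<close> is
  at most \<open>M\<close>, a supergradient has \<open>R * norm p\<close> at least
  \<open>sqrt (R\<^sup>2 - M\<^sup>2)\<close>; this bounds each step length from below and makes the
  square root grow by at least that length.\<close>

lemma prox_iter_travel:
  assumes x: "\<alpha> < R x" and h: "0 \<le> h" "h \<le> \<alpha>" and M: "M \<le> R x" "0 \<le> M" "FK K ((prox h ^^ n) x) \<le> M"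
    and Rm: "\<And>z. R z \<le> Rm"
  obtains s where "dist x ((prox h ^^ n) x) \<le> s"
    "real n * h * sqrt ((R x)\<^sup>2 - M\<^sup>2) / Rm \<le> s"
    "sqrt ((R x)\<^sup>2 - M\<^sup>2) + s \<le> sqrt ((R ((prox h ^^ n) x))\<^sup>2 - M\<^sup>2)"
proof -
  define A where "A k = sqrt ((R ((prox h ^^ k) x))\<^sup>2 - M\<^sup>2)" for k
  have "\<exists>s. dist x ((prox h ^^ k) x) \<le> s \<and> real k * h * A 0 / Rm \<le> s \<and> A 0 + s \<le> A k" if "k \<le> n" for k
    using that
  proof (induction k)
    case (Suc k)
    let ?y = "(prox h ^^ k) x" and ?z = "(prox h ^^ Suc k) x"
    obtain s where s: "dist x ?y \<le> s" "real k * h * A 0 / Rm \<le> s" "A 0 + s \<le> A k"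
      using Suc by auto
    have s0: "0 \<le> s" using s(1) zero_le_dist order_trans by blast
    obtain p where p: "\<alpha> < R ?z" "p \<in> supergrad K ?z" "?z = ?y + h *\<^sub>R p" "norm p \<le> 1"
      using is_prox_iter[OF x h(1), of k] by (rule is_proxE)
    have Ry: "R x \<le> R ?y" "R x \<le> R ?z"
      using Rdist_prox_iter_mono[OF x h, of 0 k] Rdist_prox_iter_mono[OF x h, of 0 "Suc k"] by auto
    define Z \<sigma> where "Z = R ?z * norm p" and "\<sigma> = h * norm p"
    have \<sigma>: "0 \<le> \<sigma>" "\<sigma> \<le> Z"
      unfolding Z_def \<sigma>_def using h p(1) by (auto intro!: mult_right_mono)
    \<comment> \<open>\<open>FK K\<close> is monotone along the trajectory, so the bound at its end
      holds at all earlier points.\<close>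
    have "FK K ?z \<le> M" using FK_prox_iter_mono[OF x h Suc.prems] M(3) by linarith
    then have "(FK K ?z)\<^sup>2 \<le> M\<^sup>2" by (intro power_mono FK_nonneg closed nonempty)
    then have V: "(R ?z)\<^sup>2 - M\<^sup>2 \<le> Z\<^sup>2"
      using FK_ge_supergrad[OF p(2)] by (simp add: Z_def power_mult_distrib algebra_simps)
    have step: "(R ?y)\<^sup>2 \<le> (R ?z)\<^sup>2 - 2 * \<sigma> * Z + \<sigma>\<^sup>2"
      using Rdist_prox_step[OF p(3,2)] by (simp add: Z_def \<sigma>_def power_mult_distrib algebra_simps power2_eq_square)
    have AA: "0 \<le> A j" "(A j)\<^sup>2 = (R ((prox h ^^ j) x))\<^sup>2 - M\<^sup>2" for j
    proof -
      have "M\<^sup>2 \<le> (R ((prox h ^^ j) x))\<^sup>2"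
        using M(1,2) Rdist_prox_iter_mono[OF x h, of 0 j] by (intro power_mono) auto
      then show "0 \<le> A j" "(A j)\<^sup>2 = (R ((prox h ^^ j) x))\<^sup>2 - M\<^sup>2" by (auto simp: A_def)
    qed
    \<comment> \<open>This absorbs the discretization term \<open>\<sigma>\<^sup>2\<close>, so that
      the growth by \<open>\<sigma>\<close> holds without error.\<close>
    have "(A k)\<^sup>2 \<le> (Z - \<sigma>)\<^sup>2"
      using step V unfolding AA power2_diff by (simp add: algebra_simps)
    then have Ak: "A k \<le> Z - \<sigma>" by (rule power2_le_imp_le) (use \<sigma> in simp)
    have "(A k + \<sigma>)\<^sup>2 = (A k)\<^sup>2 + 2 * \<sigma> * A k + \<sigma>\<^sup>2" by (simp add: power2_sum mult_ac)
    also have "\<dots> \<le> (A k)\<^sup>2 + 2 * \<sigma> * (Z - \<sigma>) + \<sigma>\<^sup>2"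
      using mult_left_mono[OF Ak, of "2 * \<sigma>"] \<sigma> by linarith
    also have "\<dots> \<le> (A (Suc k))\<^sup>2"
      using step unfolding AA by (simp add: algebra_simps power2_eq_square del: funpow.simps)
    finally have grow: "A k + \<sigma> \<le> A (Suc k)" by (rule power2_le_imp_le) (rule AA)
    have "A 0 \<le> Z" using s(3) s0 Ak \<sigma> by linarith
    also have "Z \<le> Rm * norm p" unfolding Z_def by (intro mult_right_mono Rm) simp
    finally have "h * A 0 \<le> h * (Rm * norm p)" by (rule mult_left_mono) (rule h)
    moreover have Rm0: "0 < Rm" using Rm[of x] x \<alpha>_pos by simp
    ultimately have "h * A 0 / Rm \<le> \<sigma>" by (simp add: \<sigma>_def pos_divide_le_eq mult_ac)
    then have "real (Suc k) * h * A 0 / Rm \<le> s + \<sigma>" using s(2) by (simp add: algebra_simps add_divide_distrib)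
    moreover have "dist ?y ?z = \<sigma>" using p(3) h by (simp add: dist_norm \<sigma>_def del: funpow.simps)
    then have "dist x ?z \<le> s + \<sigma>" using s(1) dist_triangle[of x ?z ?y] by linarith
    ultimately show ?case using grow s(3) by (intro exI[of _ "s + \<sigma>"]) (auto simp del: funpow.simps)
  qed (auto intro: exI[of _ 0])
  from this[of n] that show thesis by (auto simp: A_def)
qed

text \<open>\<open>near\<close> covers both a close set with \<open>x = a\<close> and the same set
  with a displaced point. If the run ended outside the axis, the radius gained over its length
  \<open>s\<close> would be bounded below with slope \<open>A0\<close> by \<open>K\<close> and above
  with slope \<open>Z0\<close> by \<open>K'\<close>; as \<open>A0\<close> definitely exceeds
  \<open>Z0\<close>, the run would have to be shorter.\<close>

lemma prox_iter_reaches_medial_axis: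
  fixes K' :: "'a set"
  assumes lam: "0 < lam" and mt: "0 < mt" "mt \<le> 1" and \<delta>: "0 < \<delta>" "\<delta> < lam\<^sup>2 * \<alpha> * mt / (16 * Rm\<^sup>2)"
    and grad: "\<And>y. \<alpha> < R y \<Longrightarrow> y \<notin> medial_axis lam \<alpha> K \<Longrightarrow> mt \<le> norm (gradK K y)"
    and Rm: "\<And>z. R z \<le> Rm" "\<alpha> + lam \<le> Rm"
    and K': "closed K'" "K' \<noteq> {}" and a: "a \<in> medial_axis lam \<alpha> K'"
    and near: "\<And>u. \<bar>R (x + u) - Rdist K' (a + u)\<bar> \<le> \<delta>"
    and h: "0 \<le> h" "h \<le> \<alpha>"
    and T: "real n * h = 22 / 3 * Rm\<^sup>2 / (sqrt \<alpha> * mt powr (3/2) * lam) * sqrt \<delta>"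
  shows "\<alpha> < R x" and "(prox h ^^ n) x \<in> medial_axis lam \<alpha> K"
proof -
  interpret K': prox_flow K' \<alpha> by unfold_locales (use K' \<alpha>_pos in auto)
  have Rpos: "Rm > 0" using \<alpha>_pos lam Rm(2) by linarith
  have a': "\<alpha> < Rdist K' a" "lam * Rdist K' a \<le> (Rdist K' a - \<alpha>) * FK K' a" "\<alpha> + lam \<le> Rdist K' a"
    using a lam K'.medial_axis_iff K'.medial_axis_Rdist by auto
  \<comment> \<open>As \<open>Rdist K' a\<close> is at least \<open>\<alpha> + lam\<close>, this
    leaves \<open>R x\<close> above \<open>\<alpha>\<close>.\<close>
  have "\<delta> < lam"
  proof -
    have "lam\<^sup>2 * \<alpha> * mt \<le> lam * (lam * \<alpha>) * 1"
      using lam \<alpha>_pos mt by (auto simp: power2_eq_square)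
    also have "\<dots> \<le> lam * (Rm * Rm) * 1" using lam \<alpha>_pos Rm(2) by (intro mult_mono) auto
    also have "\<dots> \<le> lam * (16 * Rm\<^sup>2)" using lam Rpos by (simp add: power2_eq_square)
    finally have "lam\<^sup>2 * \<alpha> * mt / (16 * Rm\<^sup>2) \<le> lam" using Rpos by (simp add: pos_divide_le_eq)
    then show ?thesis using \<delta> by simp
  qed
  then show x: "\<alpha> < R x" using near[of 0] a' by simp
  show "(prox h ^^ n) x \<in> medial_axis lam \<alpha> K"
  proof (rule ccontr)
    assume out: "(prox h ^^ n) x \<notin> medial_axis lam \<alpha> K"
    \<comment> \<open>\<open>m\<close> is the threshold at \<open>r0\<close>, which dominates
      \<open>Rdist K' a\<close>, and bounds \<open>FK K' a\<close> from below; \<open>M\<close> is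
      the threshold at the final radius and bounds \<open>FK K y\<close> from above.\<close>
    define y T R0 r0 r1 m M where "y = (prox h ^^ n) x" and "T = real n * h" and "R0 = R x"
      and "r0 = R0 + \<delta>" and "r1 = R y" and "m = lam * r0 / (r0 - \<alpha>)" and "M = lam * r1 / (r1 - \<alpha>)"
    have growth: "mt\<^sup>2 * T / 2 \<le> r1 - R0"
      using prox_iter_growth[OF lam x h _ grad out] mt by (simp add: T_def r1_def R0_def y_def)
    have "mt powr (3/2) = (sqrt mt)^3"
      using mt by (simp add: powr_half_sqrt[symmetric] powr_powr[symmetric] powr_realpow[symmetric] powr_powr)
    then have Teq: "T * (sqrt \<alpha> * (sqrt mt)^3 * lam) = 22 / 3 * Rm\<^sup>2 * sqrt \<delta>"
      unfolding T_def T using \<alpha>_pos mt lam by (simp add: field_simps)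
    note gap = critical_radius_gap[OF \<alpha>_pos lam mt \<delta>(1) x[folded R0_def] Rm(1)[of y, folded r1_def] Rm(2) growth Teq \<delta>(2) r0_def m_def M_def]
    have y: "\<alpha> < r1" unfolding r1_def y_def by (rule Rdist_prox_iter[OF x h(1)])
    have r0: "\<alpha> < r0" using x \<delta> by (simp add: r0_def R0_def)
    have T0: "0 \<le> T" using h by (simp add: T_def)
    define \<kappa> where "\<kappa> = m\<^sup>2 - M\<^sup>2 - 2 * \<delta> * r0"
    have \<kappa>: "4 * \<delta> * Rm\<^sup>2 < \<kappa> * T" using gap(2) by (simp add: \<kappa>_def)
    then have \<kappa>0: "0 < \<kappa>" using T0 \<delta> Rpos
      by (smt (verit, best) mult_nonneg_nonneg mult_nonpos_nonneg zero_le_power2)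
    have F': "m \<le> FK K' a"
    proof -
      have "m = lam * (1 + \<alpha> / (r0 - \<alpha>))" using r0 by (simp add: m_def field_simps)
      also have "\<dots> \<le> lam * (1 + \<alpha> / (Rdist K' a - \<alpha>))"
        using near[of 0] a' lam \<alpha>_pos by (intro mult_left_mono add_left_mono divide_left_mono) (auto simp: r0_def R0_def)
      also have "\<dots> = lam * Rdist K' a / (Rdist K' a - \<alpha>)" using a' by (simp add: field_simps)
      also have "\<dots> \<le> FK K' a" using a' by (simp add: field_simps)
      finally show ?thesis .
    qed
    have m0: "0 \<le> m" using lam r0 \<alpha>_pos by (simp add: m_def)
    have M0: "0 \<le> M" using lam y \<alpha>_pos by (simp add: M_def)
    define Z0 where "Z0 = sqrt (r0\<^sup>2 - m\<^sup>2)"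
    have r0a: "Rdist K' a \<le> r0" using near[of 0] by (simp add: r0_def R0_def)
    have fa: "(dist a (foot K' a))\<^sup>2 \<le> r0\<^sup>2 - m\<^sup>2"
      using FK_power2[OF K', of a] power_mono[OF F' m0, of 2] power_mono[OF r0a Rdist_nonneg, of 2] by linarith
    then have "0 \<le> r0\<^sup>2 - m\<^sup>2" using zero_le_power2 order_trans by blast
    then have Z0: "0 \<le> Z0" "Z0\<^sup>2 = r0\<^sup>2 - m\<^sup>2" by (auto simp: Z0_def)
    have faZ: "dist a (foot K' a) \<le> Z0" by (rule power2_le_imp_le) (use fa Z0 in simp_all)
    \<comment> \<open>The gap between the squared slopes is \<open>m\<^sup>2 - M\<^sup>2\<close>
      less the cost of replacing \<open>r0\<close> by \<open>R0\<close>.\<close>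
    have MR: "Z0\<^sup>2 + \<kappa> \<le> R0\<^sup>2 - M\<^sup>2"
    proof -
      have "R0\<^sup>2 = r0\<^sup>2 - 2 * \<delta> * r0 + \<delta>\<^sup>2" by (simp add: r0_def power2_eq_square algebra_simps)
      then show ?thesis unfolding Z0(2) \<kappa>_def using zero_le_power2[of \<delta>] by linarith
    qed
    then have "M\<^sup>2 \<le> R0\<^sup>2" using \<kappa>0 zero_le_power2[of Z0] by linarith
    then have MR0: "M \<le> R0" by (rule power2_le_imp_le) (simp add: R0_def Rdist_nonneg)
    have FM: "FK K y \<le> M"
      using out y unfolding medial_axis_iff[OF lam] y_def[symmetric] r1_def[symmetric]
      by (simp add: M_def pos_le_divide_eq mult.commute)
    obtain s where s: "dist x y \<le> s" "T * sqrt (R0\<^sup>2 - M\<^sup>2) / Rm \<le> s"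
      "sqrt (R0\<^sup>2 - M\<^sup>2) + s \<le> sqrt (r1\<^sup>2 - M\<^sup>2)"
      using prox_iter_travel[OF x h MR0[unfolded R0_def] M0 FM[unfolded y_def] Rm(1)]
      unfolding y_def[symmetric] T_def[symmetric] R0_def[symmetric] r1_def[symmetric] by blast
    define A0 where "A0 = sqrt (R0\<^sup>2 - M\<^sup>2)"
    have A0: "0 \<le> A0" "A0\<^sup>2 = R0\<^sup>2 - M\<^sup>2" using \<open>M\<^sup>2 \<le> R0\<^sup>2\<close> by (auto simp: A0_def)
    have s0: "0 \<le> s" using s(1) zero_le_dist order_trans by blast
    have "(A0 + s)\<^sup>2 \<le> (sqrt (r1\<^sup>2 - M\<^sup>2))\<^sup>2"
      using s(3) A0 s0 by (intro power_mono) (auto simp: A0_def)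
    moreover have "M\<^sup>2 \<le> r1\<^sup>2"
      using MR0 M0 gap(1) \<delta> by (intro power_mono) (auto simp: r0_def)
    ultimately have lower: "R0\<^sup>2 + 2 * s * A0 + s\<^sup>2 \<le> r1\<^sup>2"
      using A0 by (simp add: power2_sum mult_ac)
    \<comment> \<open>The hull bound for \<open>K'\<close> at \<open>a\<close> is evaluated at
      \<open>a + u\<close>, with \<open>u\<close> the displacement of the trajectory; its slope is
      the distance from \<open>a\<close> to its foot.\<close>
    have upper: "(r1 - \<delta>)\<^sup>2 \<le> r0\<^sup>2 + 2 * s * Z0 + s\<^sup>2"
    proof -
      define u where "u = y - x"
      have u: "norm u \<le> s" using s(1) by (simp add: u_def dist_norm norm_minus_commute)
      let ?c = "foot K' a"
      have "r1 - \<delta> \<le> Rdist K' (a + u)" using near[of u] by (simp add: u_def r1_def)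
      moreover have "0 \<le> r1 - \<delta>" using gap(1) x \<alpha>_pos by (simp add: r0_def R0_def)
      ultimately have "(r1 - \<delta>)\<^sup>2 \<le> (Rdist K' (a + u))\<^sup>2" by (intro power_mono)
      also have "\<dots> \<le> (dist (a + u) ?c)\<^sup>2 + (Rdist K' a)\<^sup>2 - (dist a ?c)\<^sup>2"
        by (intro Rdist_le_hull_Theta foot_in_hull K')
      also have "(dist (a + u) ?c)\<^sup>2 = (dist a ?c)\<^sup>2 + 2 * (u \<bullet> (a - ?c)) + (norm u)\<^sup>2"
        unfolding dist_norm power2_norm_eq_inner by (simp add: algebra_simps inner_commute)
      finally have 1: "(r1 - \<delta>)\<^sup>2 \<le> (Rdist K' a)\<^sup>2 + 2 * (u \<bullet> (a - ?c)) + (norm u)\<^sup>2" by simp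
      have "u \<bullet> (a - ?c) \<le> norm u * dist a ?c" by (simp add: dist_norm norm_cauchy_schwarz)
      also have "\<dots> \<le> s * Z0" using u faZ s0 by (intro mult_mono) auto
      finally have "u \<bullet> (a - ?c) \<le> s * Z0" .
      moreover have "(norm u)\<^sup>2 \<le> s\<^sup>2" using u by (intro power_mono) auto
      moreover have "(Rdist K' a)\<^sup>2 \<le> r0\<^sup>2" using r0a by (intro power_mono Rdist_nonneg)
      ultimately show ?thesis using 1 by linarith
    qed
    have "2 * s * (A0 - Z0) \<le> 2 * \<delta> * (r1 + r0) - 2 * \<delta>\<^sup>2"
      using lower upper by (simp add: r0_def algebra_simps power2_eq_square)
    then have "s * (A0 - Z0) \<le> \<delta> * (r1 + r0)" using zero_le_power2[of \<delta>] by linarith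
    also have "\<dots> \<le> \<delta> * (2 * Rm)" using gap(1) Rm(1)[of y] \<delta> by (intro mult_left_mono) (auto simp: r1_def)
    finally have sA: "s * (A0 - Z0) \<le> 2 * \<delta> * Rm" by simp
    have "Z0\<^sup>2 < A0\<^sup>2" using MR \<kappa>0 A0 by simp
    then have ZA: "Z0 < A0" by (rule power2_less_imp_less) (rule A0)
    \<comment> \<open>The factor \<open>A0 + Z0\<close>, at most \<open>2 * A0\<close>, brings in
      \<open>\<kappa>\<close>, and \<open>T * A0 \<le> s * Rm\<close> converts duration into
      length.\<close>
    have "T * \<kappa> * A0 \<le> T * A0 * (A0\<^sup>2 - Z0\<^sup>2)"
      using MR A0 T0 mult_left_mono[of \<kappa> "A0\<^sup>2 - Z0\<^sup>2" "T * A0"] by (simp add: mult_ac)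
    also have "\<dots> = T * A0 * ((A0 - Z0) * (A0 + Z0))" by (simp add: algebra_simps power2_eq_square)
    also have "\<dots> \<le> s * Rm * ((A0 - Z0) * (A0 + Z0))"
      using s(2) Rpos ZA Z0 by (intro mult_right_mono) (auto simp: A0_def[symmetric] pos_divide_le_eq)
    also have "\<dots> = Rm * (A0 + Z0) * (s * (A0 - Z0))" by (simp add: mult_ac)
    also have "\<dots> \<le> Rm * (A0 + Z0) * (2 * \<delta> * Rm)"
      using sA Rpos A0 Z0 by (intro mult_left_mono) auto
    also have "\<dots> \<le> Rm * (2 * A0) * (2 * \<delta> * Rm)"
      using Rpos \<delta> ZA by (intro mult_right_mono mult_left_mono) auto
    also have "\<dots> = 4 * \<delta> * Rm\<^sup>2 * A0" by (simp add: power2_eq_square)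
    finally have "T * \<kappa> \<le> 4 * \<delta> * Rm\<^sup>2" using ZA Z0 by (simp add: mult_le_cancel_right)
    then show False using \<kappa> by (simp add: mult.commute)
  qed
qed

end

section \<open>Paths in the medial axis\<close>

text \<open>A real upper bound in place of the exact length implies rectifiability and behaves well
  under concatenation and Lipschitz maps.\<close>

definition joined :: "'a::euclidean_space set \<Rightarrow> 'a \<Rightarrow> 'a \<Rightarrow> real \<Rightarrow> bool" where
  "joined A x y l \<longleftrightarrow>
     (\<exists>g. path g \<and> path_image g \<subseteq> A \<and> pathstart g = x \<and> pathfinish g = y \<and> path_length g \<le> ereal l)"

definition partition01 :: "(nat \<Rightarrow> real) \<Rightarrow> nat \<Rightarrow> bool" where
  "partition01 t k \<longleftrightarrow> t 0 = 0 \<and> t k = 1 \<and> (\<forall>i<k. t i \<le> t (Suc i))"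

lemma path_length_le_iff:
  "path_length g \<le> ereal l \<longleftrightarrow>
    (\<forall>t k. partition01 t k \<longrightarrow> (\<Sum>i<k. dist (g (t i)) (g (t (Suc i)))) \<le> l)"
proof -
  have "path_length g \<le> ereal l \<longleftrightarrow>
      (\<forall>t k. partition01 t k \<longrightarrow> ereal (\<Sum>i<k. dist (g (t i)) (g (t (Suc i)))) \<le> ereal l)"
    unfolding path_length_def partition01_def Sup_le_iff by blast
  then show ?thesis by (simp only: ereal_less_eq(3))
qed

lemma partition01_mem:
  assumes "partition01 t k" "i \<le> k"
  shows "t i \<in> {0..1}"
proof -
  have mono: "t i \<le> t j" if "i \<le> j" "j \<le> k" for i j
    using that
  proof (induction j rule: dec_induct)
    case (step n)
    then show ?case using assms(1) by (fastforce simp: partition01_def dest: spec[of _ n])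
  qed simp
  show ?thesis using mono[of 0 i] mono[of i k] assms by (simp add: partition01_def)
qed

lemma path_length_nonneg: "0 \<le> path_length g"
proof -
  have "partition01 real 1" by (simp add: partition01_def)
  then have "ereal (\<Sum>i<1. dist (g (real i)) (g (real (Suc i)))) \<le> path_length g"
    unfolding path_length_def partition01_def by (intro Sup_upper) blast
  moreover have "0 \<le> ereal (\<Sum>i<1. dist (g (real i)) (g (real (Suc i))))" by simp
  ultimately show ?thesis by (rule order_trans[rotated])
qed

lemma intrinsic_dist_nonneg: "0 \<le> intrinsic_dist A x y"
  unfolding intrinsic_dist_def by (rule Inf_greatest) (auto simp: path_length_nonneg)

lemma intrinsic_dist_le:
  assumes "joined A x y l"
  shows "intrinsic_dist A x y \<le> ereal l"
proof -
  obtain g where g: "path g" "path_image g \<subseteq> A" "pathstart g = x" "pathfinish g = y" "path_length g \<le> ereal l"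
    using assms by (auto simp: joined_def)
  then have "path_length g < \<infinity>" using order_le_less_trans by fastforce
  then have "intrinsic_dist A x y \<le> path_length g"
    unfolding intrinsic_dist_def using g by (intro Inf_lower) (auto simp: rectifiable_def)
  then show ?thesis using g(5) by (rule order_trans)
qed

lemma joined_if_intrinsic_dist_less:
  assumes "intrinsic_dist A x y < ereal l"
  shows "joined A x y l"
  using assms unfolding intrinsic_dist_def Inf_less_iff joined_def rectifiable_def
  by (auto intro: less_imp_le)

lemma joined_mono: "joined A x y l \<Longrightarrow> A \<subseteq> B \<Longrightarrow> l \<le> l' \<Longrightarrow> joined B x y l'"
  unfolding joined_def by (metis ereal_less_eq(3) order_trans)

lemma joined_Lipschitz_path:
  fixes g :: "real \<Rightarrow> 'a::euclidean_space"
  assumes Lip: "\<And>s s'. 0 \<le> s \<Longrightarrow> s \<le> s' \<Longrightarrow> s' \<le> 1 \<Longrightarrow> dist (g s) (g s') \<le> B * (s' - s)"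
    and A: "g ` {0..1} \<subseteq> A"
  shows "joined A (g 0) (g 1) B"
  unfolding joined_def
proof (intro exI[of _ g] conjI)
  have "dist (g 0) (g 1) \<le> B" using Lip[of 0 1] by simp
  then have "0 \<le> B" using zero_le_dist order_trans by blast
  have "B-lipschitz_on {0..1} g"
  proof (rule lipschitz_onI)
    fix s s' :: real assume "s \<in> {0..1}" "s' \<in> {0..1}"
    then show "dist (g s) (g s') \<le> B * dist s s'"
      using Lip[of s s'] Lip[of s' s] by (cases "s \<le> s'") (auto simp: dist_real_def dist_commute abs_if)
  qed (rule \<open>0 \<le> B\<close>)
  then show "path g" unfolding path_def by (rule lipschitz_on_continuous_on)
  show "path_length g \<le> ereal B"
    unfolding path_length_le_iff
  proof (intro allI impI)
    fix t k assume t: "partition01 t k"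
    have "(\<Sum>i<k. dist (g (t i)) (g (t (Suc i)))) \<le> (\<Sum>i<k. B * (t (Suc i) - t i))"
    proof (rule sum_mono)
      fix i assume "i \<in> {..<k}"
      then show "dist (g (t i)) (g (t (Suc i))) \<le> B * (t (Suc i) - t i)"
        using t partition01_mem[OF t, of i] partition01_mem[OF t, of "Suc i"]
        by (intro Lip) (auto simp: partition01_def)
    qed
    also have "\<dots> = B * (\<Sum>i<k. t (Suc i) - t i)" by (simp add: sum_distrib_left)
    also have "\<dots> = B" using t by (simp add: sum_lessThan_telescope partition01_def)
    finally show "(\<Sum>i<k. dist (g (t i)) (g (t (Suc i)))) \<le> B" .
  qed
qed (use A in \<open>auto simp: path_image_def pathstart_def pathfinish_def\<close>)

lemma joined_segment:
  assumes "closed_segment x y \<subseteq> A"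
  shows "joined A x y (dist x y)"
proof -
  have "joined A (linepath x y 0) (linepath x y 1) (dist x y)"
  proof (rule joined_Lipschitz_path)
    fix s s' :: real assume "s \<le> s'"
    have "linepath x y s - linepath x y s' = (s' - s) *\<^sub>R (x - y)"
      by (simp add: linepath_def algebra_simps)
    then show "dist (linepath x y s) (linepath x y s') \<le> dist x y * (s' - s)"
      using \<open>s \<le> s'\<close> by (simp add: dist_norm)
  qed (use assms in \<open>simp add: linepath_image_01\<close>)
  then show ?thesis by (simp add: linepath_def)
qed

lemma joined_refl: "x \<in> A \<Longrightarrow> joined A x x 0"
  using joined_segment[of x x A] by simp

lemma joined_image:
  assumes "joined S x y l" and L: "L-lipschitz_on S \<Psi>" and "\<Psi> ` S \<subseteq> A"
  shows "joined A (\<Psi> x) (\<Psi> y) (L * l)"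
proof -
  obtain g where g: "path g" "path_image g \<subseteq> S" "pathstart g = x" "pathfinish g = y" "path_length g \<le> ereal l"
    using assms by (auto simp: joined_def)
  show ?thesis
    unfolding joined_def
  proof (intro exI[of _ "\<Psi> \<circ> g"] conjI)
    have "continuous_on (path_image g) \<Psi>"
      using L g(2) by (blast intro: lipschitz_on_continuous_on continuous_on_subset)
    then show "path (\<Psi> \<circ> g)" by (rule path_continuous_image[OF g(1)])
    show "path_image (\<Psi> \<circ> g) \<subseteq> A" using g(2) assms(3) by (auto simp: path_image_compose)
    show "path_length (\<Psi> \<circ> g) \<le> ereal (L * l)"
      unfolding path_length_le_iff
    proof (intro allI impI)
      fix t k assume t: "partition01 t k"
      have "(\<Sum>i<k. dist ((\<Psi> \<circ> g) (t i)) ((\<Psi> \<circ> g) (t (Suc i)))) \<le> (\<Sum>i<k. L * dist (g (t i)) (g (t (Suc i))))"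
      proof (rule sum_mono)
        fix i assume "i \<in> {..<k}"
        then have "g (t i) \<in> S" "g (t (Suc i)) \<in> S"
          using g(2) partition01_mem[OF t, of i] partition01_mem[OF t, of "Suc i"] by (auto simp: path_image_def)
        then show "dist ((\<Psi> \<circ> g) (t i)) ((\<Psi> \<circ> g) (t (Suc i))) \<le> L * dist (g (t i)) (g (t (Suc i)))"
          using lipschitz_onD[OF L] by simp
      qed
      also have "\<dots> = L * (\<Sum>i<k. dist (g (t i)) (g (t (Suc i))))" by (simp add: sum_distrib_left)
      also have "\<dots> \<le> L * l"
        using g(5) t lipschitz_on_nonneg[OF L] by (intro mult_left_mono) (auto simp: path_length_le_iff)
      finally show "(\<Sum>i<k. dist ((\<Psi> \<circ> g) (t i)) ((\<Psi> \<circ> g) (t (Suc i)))) \<le> L * l" .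
    qed
  qed (use g in \<open>auto simp: pathstart_compose pathfinish_compose\<close>)
qed

lemma joined_sym:
  assumes "joined A x y l"
  shows "joined A y x l"
proof -
  obtain g where g: "path g" "path_image g \<subseteq> A" "pathstart g = x" "pathfinish g = y" "path_length g \<le> ereal l"
    using assms by (auto simp: joined_def)
  have "path_length (reversepath g) \<le> ereal l"
    unfolding path_length_le_iff
  proof (intro allI impI)
    fix t k assume t: "partition01 t k"
    define u where "u i = 1 - t (k - i)" for i
    have u: "partition01 u k"
      unfolding partition01_def
    proof (intro conjI allI impI)
      fix i assume "i < k"
      then have "t (k - Suc i) \<le> t (Suc (k - Suc i))" "Suc (k - Suc i) = k - i"
        using t by (auto simp: partition01_def)
      then show "u i \<le> u (Suc i)" by (simp add: u_def)
    qed (use t in \<open>auto simp: u_def partition01_def\<close>)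
    have "(\<Sum>i<k. dist (reversepath g (t i)) (reversepath g (t (Suc i))))
        = (\<Sum>i<k. dist (reversepath g (t (k - Suc i))) (reversepath g (t (Suc (k - Suc i)))))"
      by (rule sum.nat_diff_reindex[symmetric])
    also have "\<dots> = (\<Sum>i<k. dist (g (u i)) (g (u (Suc i))))"
    proof (rule sum.cong)
      fix i assume "i \<in> {..<k}"
      then have "Suc (k - Suc i) = k - i" by simp
      then show "dist (reversepath g (t (k - Suc i))) (reversepath g (t (Suc (k - Suc i)))) = dist (g (u i)) (g (u (Suc i)))"
        by (simp add: reversepath_def u_def dist_commute)
    qed simp
    also have "\<dots> \<le> l" using g(5) u by (simp add: path_length_le_iff)
    finally show "(\<Sum>i<k. dist (reversepath g (t i)) (reversepath g (t (Suc i)))) \<le> l" .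
  qed
  then show ?thesis unfolding joined_def using g by (intro exI[of _ "reversepath g"]) auto
qed

lemma joined_trans:
  assumes "joined A x y l" "joined A y z l'"
  shows "joined A x z (l + l')"
proof -
  obtain g where g: "path g" "path_image g \<subseteq> A" "pathstart g = x" "pathfinish g = y" "path_length g \<le> ereal l"
    using assms by (auto simp: joined_def)
  obtain g' where g': "path g'" "path_image g' \<subseteq> A" "pathstart g' = y" "pathfinish g' = z" "path_length g' \<le> ereal l'"
    using assms by (auto simp: joined_def)
  define j where "j = g +++ g'"
  have "path_length j \<le> ereal (l + l')"
    unfolding path_length_le_iff
  proof (intro allI impI)
    fix t k assume t: "partition01 t k"
    \<comment> \<open>A partition for the joined path is clipped to one for each half.\<close>
    define c d where "c i = min 1 (2 * t i)" and "d i = max 0 (2 * t i - 1)" for i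
    have cd: "partition01 c k" "partition01 d k"
      using t by (auto simp: partition01_def c_def d_def min_def max_def)
    have "(\<Sum>i<k. dist (j (t i)) (j (t (Suc i))))
        \<le> (\<Sum>i<k. dist (g (c i)) (g (c (Suc i))) + dist (g' (d i)) (g' (d (Suc i))))"
    proof (rule sum_mono)
      fix i assume "i \<in> {..<k}"
      then have ti: "t i \<le> t (Suc i)" using t by (simp add: partition01_def)
      have mid: "g 1 = g' 0" using g(4) g'(3) by (simp add: pathstart_def pathfinish_def)
      \<comment> \<open>Only an interval straddling 1/2 meets both halves and needs the triangle
        inequality through the junction.\<close>
      consider "t (Suc i) \<le> 1/2" | "t i > 1/2" | "t i \<le> 1/2" "t (Suc i) > 1/2" by linarith
      then show "dist (j (t i)) (j (t (Suc i))) \<le> dist (g (c i)) (g (c (Suc i))) + dist (g' (d i)) (g' (d (Suc i)))"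
      proof cases
        case 3
        then have "j (t i) = g (c i)" "j (t (Suc i)) = g' (d (Suc i))" "c (Suc i) = 1" "d i = 0"
          by (auto simp: j_def joinpaths_def c_def d_def)
        then show ?thesis using dist_triangle[of "g (c i)" "g' (d (Suc i))" "g 1"] mid by simp
      qed (use ti in \<open>auto simp: j_def joinpaths_def c_def d_def\<close>)
    qed
    also have "\<dots> \<le> l + l'"
      using cd g(5) g'(5) by (simp add: sum.distrib path_length_le_iff add_mono)
    finally show "(\<Sum>i<k. dist (j (t i)) (j (t (Suc i)))) \<le> l + l'" .
  qed
  then show ?thesis
    unfolding joined_def using g g' by (intro exI[of _ j]) (auto simp: j_def path_image_join)
qed

text \<open>Connectedness joins any two points by a path of some finite length; a finite cover of
  \<open>W\<close> by balls makes the bound uniform.\<close>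

lemma joined_compact_bound:
  fixes U :: "'a::euclidean_space set"
  assumes "open U" "connected U" "compact W" "W \<subseteq> U"
  obtains l where "\<And>x y. x \<in> W \<Longrightarrow> y \<in> W \<Longrightarrow> joined U x y l"
proof -
  have conn: "\<exists>l. joined U x y l" if "x \<in> U" "y \<in> U" for x y
  proof (rule connected_equivalence_relation[OF assms(2) that])
    fix a assume "a \<in> U"
    then obtain e where e: "e > 0" "ball a e \<subseteq> U" using assms(1) openE by blast
    have "joined U a b (dist a b)" if "b \<in> ball a e" for b
      by (rule joined_segment) (use that e closed_segment_subset[of a "ball a e" b] in auto)
    then show "\<exists>T. openin (top_of_set U) T \<and> a \<in> T \<and> (\<forall>x\<in>T. \<exists>l. joined U a x l)"
      using e by (intro exI[of _ "ball a e"] conjI) (auto simp: openin_open_eq assms(1), blast)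
  qed (blast intro: joined_sym joined_trans)+
  have "\<forall>a\<in>W. \<exists>e>0. ball a e \<subseteq> U" using assms(1,4) by (meson openE subsetD)
  then obtain e where e: "\<And>a. a \<in> W \<Longrightarrow> e a > 0" "\<And>a. a \<in> W \<Longrightarrow> ball a (e a) \<subseteq> U" by metis
  have "W \<subseteq> (\<Union>a\<in>W. ball a (e a))" using e by fastforce
  then obtain F where F: "F \<subseteq> W" "finite F" "W \<subseteq> (\<Union>a\<in>F. ball a (e a))"
    by (rule compactE_image[OF assms(3), rotated]) auto
  have "\<forall>p\<in>F \<times> F. \<exists>l. joined U (fst p) (snd p) l"
  proof
    fix p assume "p \<in> F \<times> F"
    then have "fst p \<in> U" "snd p \<in> U" using F(1) assms(4) by auto
    then show "\<exists>l. joined U (fst p) (snd p) l" by (rule conn)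
  qed
  then obtain l where l: "\<And>a b. a \<in> F \<Longrightarrow> b \<in> F \<Longrightarrow> joined U a b (l (a, b))"
    by (metis SigmaI fst_conv snd_conv)
  \<comment> \<open>Sums of absolute values stand in for maxima and also make sense when
    \<open>F\<close> is empty.\<close>
  define m where "m = (\<Sum>p\<in>F \<times> F. \<bar>l p\<bar>)"
  define E where "E = (\<Sum>a\<in>F. \<bar>e a\<bar>)"
  have near: "\<exists>a\<in>F. joined U x a E" if xW: "x \<in> W" for x
  proof -
    obtain a where a: "a \<in> F" "x \<in> ball a (e a)" using xW F(3) by blast
    have "joined U x a (dist x a)"
      by (rule joined_segment) (use a F e closed_segment_subset[of x "ball a (e a)" a] in fastforce)
    moreover have "\<bar>e a\<bar> \<le> E" unfolding E_def using a F by (intro member_le_sum) auto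
    then have "dist x a \<le> E" using a by (simp add: dist_commute)
    ultimately show ?thesis using a joined_mono by blast
  qed
  have "joined U x y (E + m + E)" if xy: "x \<in> W" "y \<in> W" for x y
  proof -
    obtain a b where ab: "a \<in> F" "joined U x a E" "b \<in> F" "joined U y b E" using near xy by blast
    have "\<bar>l (a, b)\<bar> \<le> m" unfolding m_def using ab F by (intro member_le_sum) auto
    then have "joined U a b m" using l[OF ab(1,3)] by (auto elim: joined_mono)
    then show ?thesis using ab joined_trans joined_sym by blast
  qed
  then show thesis by (rule that)
qed

section \<open>Pushing paths into the medial axis\<close>

context prox_flow
begin

lemma prox_0:
  assumes "\<alpha> < R x"
  shows "prox 0 x = x"
  using is_prox_prox[OF assms, of 0] by (auto simp: is_prox_def)

text \<open>The resolvent identity \<open>prox s' x = prox s (x + (s' - s) p)\<close> makes \<open>s \<mapsto> prox s x\<close> Lipschitz.\<close>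

lemma dist_prox_prox_le:
  assumes x: "\<alpha> < R x" and s: "0 \<le> s" "s \<le> s'" "s' \<le> h" "h < \<alpha>"
  shows "dist (prox s x) (prox s' x) \<le> (s' - s) / (1 - h / \<alpha>)"
proof -
  have s': "0 \<le> s'" using s by simp
  obtain p where p: "\<alpha> < R (prox s' x)" "p \<in> supergrad K (prox s' x)" "prox s' x = x + s' *\<^sub>R p" "norm p \<le> 1"
    using is_prox_prox[OF x s'] by (rule is_proxE)
  have "prox s' x = (x + (s' - s) *\<^sub>R p) + s *\<^sub>R p" using p(3) by (simp add: algebra_simps)
  then have "is_prox s (x + (s' - s) *\<^sub>R p) (prox s' x)" using p by (auto simp: is_prox_def)
  from is_prox_Lipschitz[OF is_prox_prox[OF x s(1)] this]
  have "dist (prox s x) (prox s' x) \<le> (s' - s) * norm p / (1 - s / \<alpha>)"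
    using s by (simp add: dist_norm)
  also have "\<dots> \<le> (s' - s) * 1 / (1 - h / \<alpha>)"
    using s p(4) \<alpha>_pos by (intro frac_le mult_left_mono) (auto intro!: divide_right_mono)
  finally show ?thesis by simp
qed

text \<open>The curve of all \<open>prox (s * h) x\<close> with \<open>s\<close> from 0 to 1 is
  Lipschitz, and each of its points is a single step from \<open>x\<close>, hence in the
  axis.\<close>

lemma joined_prox:
  assumes lam: "0 < lam" and x: "x \<in> medial_axis lam \<alpha> K" and h: "0 \<le> h" "h < \<alpha>"
  shows "joined (medial_axis lam \<alpha> K) x (prox h x) (h / (1 - h / \<alpha>))"
proof -
  have Rx: "\<alpha> < R x" using x lam medial_axis_iff by blast
  have "joined (medial_axis lam \<alpha> K) (prox (0 * h) x) (prox (1 * h) x) (h / (1 - h / \<alpha>))"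
  proof (rule joined_Lipschitz_path)
    fix s s' :: real assume s: "0 \<le> s" "s \<le> s'" "s' \<le> 1"
    have "dist (prox (s * h) x) (prox (s' * h) x) \<le> (s' * h - s * h) / (1 - h / \<alpha>)"
      using s h by (intro dist_prox_prox_le Rx) (auto intro: mult_right_mono mult_left_le_one_le)
    then show "dist (prox (s * h) x) (prox (s' * h) x) \<le> h / (1 - h / \<alpha>) * (s' - s)"
      by (simp add: algebra_simps)
  next
    show "(\<lambda>s. prox (s * h) x) ` {0..1} \<subseteq> medial_axis lam \<alpha> K"
    proof (rule image_subsetI)
      fix s :: real assume "s \<in> {0..1}"
      then have "0 \<le> s * h" "s * h \<le> \<alpha>"
        using h mult_left_le_one_le[of h s] by auto
      then show "prox (s * h) x \<in> medial_axis lam \<alpha> K"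
        using medial_axis_prox[OF lam is_prox_prox[OF Rx] _ _ x] by blast
    qed
  qed
  then show ?thesis by (simp add: prox_0[OF Rx])
qed

lemma joined_prox_iter:
  assumes lam: "0 < lam" and x: "x \<in> medial_axis lam \<alpha> K" and h: "0 \<le> h" "h < \<alpha>"
  shows "joined (medial_axis lam \<alpha> K) x ((prox h ^^ n) x) (real n * h / (1 - h / \<alpha>))"
proof (induction n)
  case 0
  then show ?case using joined_refl[OF x] by simp
next
  case (Suc n)
  have Rx: "\<alpha> < R x" using x lam medial_axis_iff by blast
  have "(prox h ^^ n) x \<in> medial_axis lam \<alpha> K"
    by (rule medial_axis_prox_iter[OF lam Rx, of h 0]) (use h x in auto)
  from joined_trans[OF Suc joined_prox[OF lam this h]] show ?case
    by (simp add: algebra_simps add_divide_distrib)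
qed

text \<open>With step size \<open>T / n\<close> the new path follows the trajectory of
  \<open>x\<close>, then the image of the given path, then the trajectory of \<open>y\<close>
  backwards. The Lipschitz constant of the \<open>n\<close> steps tends to
  \<open>exp (T / \<alpha>)\<close>.\<close>

lemma intrinsic_dist_push:
  assumes lam: "0 < lam" and xy: "x \<in> medial_axis lam \<alpha> K" "y \<in> medial_axis lam \<alpha> K"
    and S: "\<And>z. z \<in> S \<Longrightarrow> \<alpha> < R z" and l: "joined S x y l" and T: "0 < T"
    and reach: "\<And>n h z. 0 \<le> h \<Longrightarrow> h \<le> \<alpha> \<Longrightarrow> real n * h = T \<Longrightarrow> z \<in> S \<Longrightarrow> (prox h ^^ n) z \<in> medial_axis lam \<alpha> K"
  shows "intrinsic_dist (medial_axis lam \<alpha> K) x y \<le> ereal (2 * T + exp (T / \<alpha>) * l)"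
proof -
  let ?A = "medial_axis lam \<alpha> K"
  define b where "b n = T / (1 - T / real n / \<alpha>) + inverse ((1 + (- T / \<alpha>) / real n) ^ n) * l + T / (1 - T / real n / \<alpha>)" for n
  have bound: "intrinsic_dist ?A x y \<le> ereal (b n)" if n: "T / \<alpha> < real n" for n
  proof -
    define h where "h = T / real n"
    have n0: "real n > 0" using n T \<alpha>_pos by (meson divide_pos_pos order_less_trans)
    have h: "0 \<le> h" "h < \<alpha>" "real n * h = T"
      using n n0 T \<alpha>_pos by (auto simp: h_def field_simps)
    have L: "(inverse ((1 - h / \<alpha>) ^ n))-lipschitz_on S (prox h ^^ n)"
    proof (rule lipschitz_onI)
      fix z w assume "z \<in> S" "w \<in> S"
      then show "dist ((prox h ^^ n) z) ((prox h ^^ n) w) \<le> inverse ((1 - h / \<alpha>) ^ n) * dist z w"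
        using prox_iter_Lipschitz[OF S S h(1,2)] by (simp add: divide_inverse mult.commute)
    qed (use h \<alpha>_pos in simp)
    have "joined ?A ((prox h ^^ n) x) ((prox h ^^ n) y) (inverse ((1 - h / \<alpha>) ^ n) * l)"
      by (rule joined_image[OF l L]) (use reach h in auto)
    with joined_prox_iter[OF lam xy(1) h(1,2)] joined_sym[OF joined_prox_iter[OF lam xy(2) h(1,2)]]
    have "joined ?A x y (real n * h / (1 - h / \<alpha>) + inverse ((1 - h / \<alpha>) ^ n) * l + real n * h / (1 - h / \<alpha>))"
      using joined_trans by blast
    moreover have "1 - h / \<alpha> = 1 + (- T / \<alpha>) / real n" by (simp add: h_def mult.commute)
    ultimately have "joined ?A x y (b n)" unfolding b_def h(3) h_def[symmetric] by simp
    then show ?thesis by (rule intrinsic_dist_le)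
  qed
  have "(\<lambda>n. T / real n) \<longlonglongrightarrow> 0" by (rule lim_const_over_n)
  then have "b \<longlonglongrightarrow> T / (1 - 0 / \<alpha>) + inverse (exp (- T / \<alpha>)) * l + T / (1 - 0 / \<alpha>)"
    unfolding b_def using \<alpha>_pos by (intro tendsto_intros tendsto_exp_limit_sequentially) auto
  then have "b \<longlonglongrightarrow> 2 * T + exp (T / \<alpha>) * l" by (simp add: exp_minus algebra_simps)
  then have "(\<lambda>n. ereal (b n)) \<longlonglongrightarrow> ereal (2 * T + exp (T / \<alpha>) * l)" by simp
  moreover have "\<exists>N. \<forall>n\<ge>N. intrinsic_dist ?A x y \<le> ereal (b n)"
  proof -
    obtain N where "T / \<alpha> < real N" using reals_Archimedean2 by blast
    then show ?thesis by (intro exI[of _ N]) (auto intro!: bound)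
  qed
  ultimately show ?thesis by (rule LIMSEQ_le_const)
qed

end

section \<open>Stability\<close>

lemma r_mu_mono:
  assumes "\<alpha>' \<le> \<alpha>"
  shows "r_mu \<mu> \<alpha>' K \<le> r_mu \<mu> \<alpha> K"
  unfolding r_mu_def using assms by (intro Inf_superset_mono image_mono) auto

lemma mu_tilde_bounds:
  assumes "0 < \<mu>" "\<mu> \<le> 1" "0 < lam" "ereal (\<alpha> + lam) < r_mu \<mu> \<alpha> K"
  shows "0 < mu_tilde \<mu> lam \<alpha> \<alpha> K" "mu_tilde \<mu> lam \<alpha> \<alpha> K \<le> 1"
proof -
  show "mu_tilde \<mu> lam \<alpha> \<alpha> K \<le> 1" using assms(2) by (auto simp: mu_tilde_def)
  show "0 < mu_tilde \<mu> lam \<alpha> \<alpha> K"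
  proof (cases "r_mu \<mu> \<alpha> K")
    case (real r)
    then have "lam < r - \<alpha>" using assms(4) by simp
    then have "(lam / (r - \<alpha>))\<^sup>2 < 1" using assms(3) by (simp add: power_less_one_iff)
    then show ?thesis using assms(1) real by (simp add: mu_tilde_def)
  qed (use assms in \<open>auto simp: mu_tilde_def\<close>)
qed

context prox_flow
begin

text \<open>Below \<open>r_mu\<close> the critical function is at least \<open>\<mu>\<close>. At or
  beyond it, a point off the axis has a small enclosing radius, and
  \<open>(FK K y)\<^sup>2 = (R y)\<^sup>2 * (1 - q\<^sup>2)\<close> turns this into a lower bound on
  \<open>q\<close>.\<close>

lemma mu_tilde_le_norm_gradK:
  assumes lam: "0 < lam" and r: "ereal (\<alpha> + lam) < r_mu \<mu> \<alpha> K"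
    and y: "\<alpha> < R y" "y \<notin> medial_axis lam \<alpha> K"
  shows "mu_tilde \<mu> lam \<alpha> \<alpha> K \<le> norm (gradK K y)"
proof (cases "ereal (R y) < r_mu \<mu> \<alpha> K")
  case True
  have "\<not> chiK K (R y) < \<mu>"
  proof
    assume "chiK K (R y) < \<mu>"
    then have "r_mu \<mu> \<alpha> K \<le> ereal (R y)" unfolding r_mu_def using y(1) by (intro Inf_lower) auto
    then show False using True by simp
  qed
  moreover have "{x. R x = R y} \<noteq> {}" by blast
  then have "chiK K (R y) = Inf ((\<lambda>x. norm (gradK K x)) ` {x. R x = R y})"
    unfolding chiK_def by (simp only: if_False)
  moreover have "\<dots> \<le> norm (gradK K y)"
    by (rule cInf_lower) (auto intro!: bdd_belowI[of _ 0])
  moreover have "mu_tilde \<mu> lam \<alpha> \<alpha> K \<le> \<mu>" by (simp add: mu_tilde_def)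
  ultimately show ?thesis by linarith
next
  case False
  then obtain r where r': "r_mu \<mu> \<alpha> K = ereal r" "r \<le> R y" "\<alpha> + lam < r"
    using r by (cases "r_mu \<mu> \<alpha> K") auto
  define q where "q = norm (gradK K y)"
  have Ry: "0 < R y" using y \<alpha>_pos by simp
  have "dist y (foot K y) = q * R y" using Ry by (simp add: q_def norm_gradK[OF closed nonempty])
  then have F: "(FK K y)\<^sup>2 = (R y)\<^sup>2 * (1 - q\<^sup>2)"
    by (simp add: FK_power2[OF closed nonempty] power_mult_distrib algebra_simps)
  have "(R y - \<alpha>) * FK K y < lam * R y" using y by (simp add: medial_axis_iff[OF lam])
  then have "((R y - \<alpha>) * FK K y)\<^sup>2 \<le> (lam * R y)\<^sup>2"
    using y FK_nonneg[OF closed nonempty, of y] by (intro power_mono) auto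
  then have "(R y)\<^sup>2 * ((R y - \<alpha>)\<^sup>2 * (1 - q\<^sup>2)) \<le> (R y)\<^sup>2 * lam\<^sup>2"
    by (simp add: power_mult_distrib F mult_ac)
  then have "(R y - \<alpha>)\<^sup>2 * (1 - q\<^sup>2) \<le> lam\<^sup>2" using Ry by simp
  then have "1 - q\<^sup>2 \<le> (lam / (R y - \<alpha>))\<^sup>2"
    using y by (simp add: power_divide pos_le_divide_eq mult.commute)
  also have "\<dots> \<le> (lam / (r - \<alpha>))\<^sup>2"
    using r' lam by (intro power_mono divide_left_mono) auto
  finally have "sqrt (1 - (lam / (r - \<alpha>))\<^sup>2) \<le> q" by (intro real_le_lsqrt) (auto simp: q_def)
  then show ?thesis using r' by (simp add: mu_tilde_def q_def)
qed

end

section \<open>Distance functions, their maxima and the Hausdorff distance\<close>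

lemma Rdist_le_Rmax:
  assumes "closed K" "K \<noteq> {}" "bounded (- K)" "z \<notin> K"
  shows "Rdist K z \<le> Rmax K"
  unfolding Rmax_def
proof (rule cSUP_upper)
  obtain k where k: "k \<in> K" using assms(2) by blast
  obtain e where e: "\<And>z. z \<in> - K \<Longrightarrow> dist k z \<le> e" using assms(3) unfolding bounded_any_center[of _ k] by blast
  have "Rdist K z \<le> e" if "z \<in> - K" for z
    using infdist_le[OF k, of z] e[OF that] by (simp add: Rdist_def dist_commute)
  then show "bdd_above (Rdist K ` (- K))" by (intro bdd_aboveI2)
qed (use assms in simp)

lemma Rdist_le_hdist:
  assumes "K' \<noteq> {}" "closed K" "K \<noteq> {}" "hdist K K' < ereal e"
  shows "Rdist K' z \<le> Rdist K z + e"
proof -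
  obtain y where y: "y \<in> K" "dist z y = Rdist K z" using Theta_nonempty[OF assms(2,3), of z] by (auto simp: Theta_def)
  have "ereal (infdist y K') \<le> hdist K K'"
    unfolding hdist_def using y by (intro max.coboundedI1 SUP_upper)
  then have "infdist y K' < e" using assms(4) by (metis ereal_less(2) less_ereal.simps(1) order_le_less_trans)
  then show ?thesis using Rdist_triangle[of K' z y] y by (simp add: Rdist_def)
qed

lemma hdist_commute: "hdist K K' = hdist K' K"
  by (simp add: hdist_def max.commute)

section \<open>Transfer of intrinsic distances between close sets\<close>

locale medial_flow = prox_flow +
  fixes lam mt Rm :: real
  assumes lam: "0 < lam" and mt: "0 < mt" "mt \<le> 1"
    and grad: "\<And>y. \<alpha> < R y \<Longrightarrow> y \<notin> medial_axis lam \<alpha> K \<Longrightarrow> mt \<le> norm (gradK K y)"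
    and Rm: "\<And>z. R z \<le> Rm" "\<alpha> + lam \<le> Rm"
begin

text \<open>The constant \<open>C\<close> of the theorem. \<open>mt\<close> and \<open>Rm\<close>
  are locale parameters so that both sets can share them.\<close>

definition holder_const :: real where
  "holder_const = 22 / 3 * Rm\<^sup>2 / (sqrt \<alpha> * mt powr (3/2) * lam)"

text \<open>The closeness required for the arrival estimate, applied first to the distance of the
  two sets and then to the displacement \<open>T\<close> it causes.\<close>

abbreviation threshold :: real where
  "threshold \<equiv> lam\<^sup>2 * \<alpha> * mt / (16 * Rm\<^sup>2)"

lemma holder_const_pos: "0 < holder_const"
proof -
  have "0 < Rm" using \<alpha>_pos lam Rm(2) by linarith
  then show ?thesis using \<alpha>_pos lam mt by (simp add: holder_const_def)
qed

lemma reach: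
  assumes "0 < \<delta>" "\<delta> < threshold" "closed K'" "K' \<noteq> {}" "a \<in> medial_axis lam \<alpha> K'"
    "\<And>u. \<bar>R (x + u) - Rdist K' (a + u)\<bar> \<le> \<delta>"
  shows "\<alpha> < R x"
    and "0 \<le> h \<Longrightarrow> h \<le> \<alpha> \<Longrightarrow> real n * h = holder_const * sqrt \<delta> \<Longrightarrow> (prox h ^^ n) x \<in> medial_axis lam \<alpha> K"
proof -
  have pos: "0 < holder_const * sqrt \<delta>" using holder_const_pos assms(1) by simp
  note r = prox_iter_reaches_medial_axis[OF lam mt assms(1,2) grad Rm assms(3-6)]
  \<comment> \<open>The arrival estimate speaks of a given run of steps, so a run with step size at
    most \<open>\<alpha>\<close> is supplied to obtain \<open>\<alpha> < R x\<close>.\<close>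
  obtain N where N: "holder_const * sqrt \<delta> / \<alpha> < real N" using reals_Archimedean2 by blast
  then have N0: "0 < real N" using pos \<alpha>_pos by (meson divide_pos_pos order_less_trans)
  define k where "k = holder_const * sqrt \<delta> / real N"
  have "0 \<le> k" "k \<le> \<alpha>" "real N * k = holder_const * sqrt \<delta>"
    using N N0 pos \<alpha>_pos by (auto simp: k_def field_simps)
  then show "\<alpha> < R x" using r(1) by (simp add: holder_const_def)
  show "0 \<le> h \<Longrightarrow> h \<le> \<alpha> \<Longrightarrow> real n * h = holder_const * sqrt \<delta> \<Longrightarrow> (prox h ^^ n) x \<in> medial_axis lam \<alpha> K"
    using r(2) by (simp add: holder_const_def)
qed

text \<open>The end of the trajectory of \<open>a\<close> serves: its displacement is at most the
  total time.\<close>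

lemma medial_axis_near:
  assumes \<delta>: "0 < \<delta>" "\<delta> < threshold" and K': "closed K'" "K' \<noteq> {}" "a \<in> medial_axis lam \<alpha> K'"
    and near: "\<And>z. \<bar>R z - Rdist K' z\<bar> \<le> \<delta>"
  shows "\<exists>x \<in> medial_axis lam \<alpha> K. dist a x \<le> holder_const * sqrt \<delta>"
proof -
  let ?T = "holder_const * sqrt \<delta>"
  have pos: "0 < ?T" using holder_const_pos \<delta> by simp
  obtain N where N: "?T / \<alpha> < real N" using reals_Archimedean2 by blast
  then have N0: "0 < real N" using pos \<alpha>_pos by (meson divide_pos_pos order_less_trans)
  define h where "h = ?T / real N"
  have h: "0 \<le> h" "h \<le> \<alpha>" "real N * h = ?T"
    using N N0 pos \<alpha>_pos by (auto simp: h_def field_simps)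
  note r = reach[OF \<delta> K' near]
  show ?thesis
    using dist_prox_iter_le[OF r(1) h(1), of N] r(2)[OF h] h(3) by (intro bexI[of _ "(prox h ^^ N) a"]) auto
qed

text \<open>The tube \<open>S\<close> of radius \<open>T\<close> around the axis of \<open>K\<close>
  contains the axis of \<open>K'\<close> and the segments from \<open>x\<close> to \<open>x'\<close>
  and from \<open>y\<close> to \<open>y'\<close>. Comparing \<open>K\<close> with its own
  displacements shows that the flow carries \<open>S\<close> into the axis in time
  \<open>T2\<close>.\<close>

lemma intrinsic_dist_transfer:
  fixes K' :: "'a set"
  assumes \<delta>: "0 < \<delta>" "\<delta> < threshold" and K': "closed K'" "K' \<noteq> {}"
    and near: "\<And>z. \<bar>R z - Rdist K' z\<bar> \<le> \<delta>"
    and T: "T = holder_const * sqrt \<delta>" "T < threshold" and T2: "T2 = holder_const * sqrt T"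
    and x: "x \<in> medial_axis lam \<alpha> K" "x' \<in> medial_axis lam \<alpha> K'" "dist x x' \<le> T"
    and y: "y \<in> medial_axis lam \<alpha> K" "y' \<in> medial_axis lam \<alpha> K'" "dist y y' \<le> T"
    and l: "joined (medial_axis lam \<alpha> K') x' y' l"
  shows "intrinsic_dist (medial_axis lam \<alpha> K) x y \<le> ereal (2 * T2 + exp (T2 / \<alpha>) * (2 * T + l))"
proof -
  define S where "S = {z. \<exists>a \<in> medial_axis lam \<alpha> K. dist z a \<le> T}"
  have Tpos: "0 < T" using holder_const_pos \<delta> T by simp
  have nearS: "\<bar>R (z + u) - R (a + u)\<bar> \<le> T" if "dist z a \<le> T" for z a u
    using that Rdist_triangle[of K "z + u" "a + u"] Rdist_triangle[of K "a + u" "z + u"]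
    by (simp add: dist_commute)
  have S: "\<alpha> < R z" if "z \<in> S" for z
    using that reach(1)[OF Tpos T(2) closed nonempty _ nearS] by (auto simp: S_def)
  have reachS: "(prox h ^^ n) z \<in> medial_axis lam \<alpha> K"
    if "0 \<le> h" "h \<le> \<alpha>" "real n * h = T2" "z \<in> S" for n h z
    using that reach(2)[OF Tpos T(2) closed nonempty _ nearS] T2 by (auto simp: S_def)
  have "medial_axis lam \<alpha> K' \<subseteq> S"
    using medial_axis_near[OF \<delta> K' _ near] T(1) by (auto simp: S_def)
  then have mid: "joined S x' y' l" by (rule joined_mono[OF l]) simp
  have seg: "joined S a b T" if "a \<in> medial_axis lam \<alpha> K" "dist a b \<le> T" for a b
  proof -
    have "closed_segment a b \<subseteq> S"
    proof
      fix z assume "z \<in> closed_segment a b"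
      then have "dist a z \<le> dist a b" 
        using segment_bound(1)[of z a b] by (simp add: dist_norm norm_minus_commute)
      then show "z \<in> S" using that by (auto simp: S_def dist_commute intro!: bexI[of _ a])
    qed
    then show ?thesis using joined_segment joined_mono that(2) by blast
  qed
  have "joined S x y (T + l + T)"
    using joined_trans[OF joined_trans[OF seg[OF x(1,3)] mid] joined_sym[OF seg[OF y(1,3)]]] .
  then have "joined S x y (2 * T + l)" by (simp add: algebra_simps)
  then show ?thesis
    using Tpos T2 holder_const_pos by (intro intrinsic_dist_push[OF lam x(1) y(1) S _ _ reachS]) auto
qed

lemma real_intrinsic_dist_transfer:
  fixes K' :: "'a set"
  assumes \<delta>: "0 < \<delta>" "\<delta> < threshold" and K': "closed K'" "K' \<noteq> {}"
    and near: "\<And>z. \<bar>R z - Rdist K' z\<bar> \<le> \<delta>"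
    and T: "T = holder_const * sqrt \<delta>" "T < threshold" and T2: "T2 = holder_const * sqrt T"
    and x: "x \<in> medial_axis lam \<alpha> K" "x' \<in> medial_axis lam \<alpha> K'" "dist x x' \<le> T"
    and y: "y \<in> medial_axis lam \<alpha> K" "y' \<in> medial_axis lam \<alpha> K'" "dist y y' \<le> T"
    and fin: "intrinsic_dist (medial_axis lam \<alpha> K') x' y' < \<infinity>"
  shows "real_of_ereal (intrinsic_dist (medial_axis lam \<alpha> K) x y)
    \<le> 2 * T2 + exp (T2 / \<alpha>) * (2 * T + real_of_ereal (intrinsic_dist (medial_axis lam \<alpha> K') x' y'))"
    (is "real_of_ereal ?d \<le> _ + _ * (_ + real_of_ereal ?d')")
proof (rule field_le_epsilon)
  fix e :: real assume e: "0 < e"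
  \<comment> \<open>The infimum need not be attained; the slack is divided by the factor that later
    stretches the path.\<close>
  define l where "l = real_of_ereal ?d' + e / exp (T2 / \<alpha>)"
  have "?d' = ereal (real_of_ereal ?d')"
    using fin intrinsic_dist_nonneg[of "medial_axis lam \<alpha> K'" x' y'] by (cases ?d') auto
  moreover have "ereal (real_of_ereal ?d') < ereal l" using e by (simp add: l_def)
  ultimately have "joined (medial_axis lam \<alpha> K') x' y' l"
    by (intro joined_if_intrinsic_dist_less) metis
  from intrinsic_dist_transfer[OF \<delta> K' near T T2 x y this]
  have "real_of_ereal ?d \<le> 2 * T2 + exp (T2 / \<alpha>) * (2 * T + l)"
    using intrinsic_dist_nonneg[of "medial_axis lam \<alpha> K" x y] by (cases ?d) auto
  then show "real_of_ereal ?d \<le> 2 * T2 + exp (T2 / \<alpha>) * (2 * T + real_of_ereal ?d') + e"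
    by (simp add: l_def algebra_simps)
qed

text \<open>The axis lies in a compact subset of the connected open complement of the offset. Paths
  of uniformly bounded length there are pushed into the axis.\<close>

lemma Gdiam_medial_axis_finite:
  assumes "bounded (- K)" "connected (- offset K \<alpha>)"
  shows "Gdiam (medial_axis lam \<alpha> K) < \<infinity>"
proof -
  let ?A = "medial_axis lam \<alpha> K" and ?U = "- offset K \<alpha>"
  have U: "?U = {z. \<alpha> < R z}" by (auto simp: offset_def Rdist_def)
  have "open ?U" unfolding U by (intro open_Collect_less continuous_on_Rdist continuous_intros)
  define W where "W = {z. \<alpha> + lam \<le> R z}"
  have "closed W" unfolding W_def by (intro closed_Collect_le continuous_on_Rdist continuous_intros)
  moreover have "W \<subseteq> - K" using \<alpha>_pos lam by (auto simp: W_def Rdist_def)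
  ultimately have "compact W" using assms(1) by (auto simp: compact_eq_bounded_closed intro: bounded_subset)
  moreover have "W \<subseteq> ?U" using lam by (auto simp: U W_def)
  ultimately obtain l where l: "\<And>x y. x \<in> W \<Longrightarrow> y \<in> W \<Longrightarrow> joined ?U x y l"
    using joined_compact_bound[OF \<open>open ?U\<close> assms(2)] by metis
  \<comment> \<open>After this time the growth outside the axis would exceed the bound
    \<open>Rm\<close> on the radius.\<close>
  define T where "T = 2 * Rm / mt\<^sup>2"
  have T: "0 < T" "Rm \<le> mt\<^sup>2 * T / 2" using mt Rm(2) \<alpha>_pos lam by (auto simp: T_def)
  have "intrinsic_dist ?A x y \<le> ereal (2 * T + exp (T / \<alpha>) * l)" if "x \<in> ?A" "y \<in> ?A" for x y
  proof (rule intrinsic_dist_push[OF lam that _ _ T(1)])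
    show "joined ?U x y l" using l that medial_axis_Rdist[OF lam] by (auto simp: W_def)
    show "(prox h ^^ n) z \<in> ?A" if "0 \<le> h" "h \<le> \<alpha>" "real n * h = T" "z \<in> ?U" for n h z
      by (rule prox_iter_enters_medial_axis[OF lam _ that(1,2) _ grad Rm(1)])
        (use that T mt in \<open>auto simp: U\<close>)
  qed (simp add: U)
  then have "Gdiam ?A \<le> ereal (2 * T + exp (T / \<alpha>) * l)"
    unfolding Gdiam_def by (auto intro!: Sup_least)
  then show ?thesis using order_le_less_trans by fastforce
qed

end

section \<open>The Gromov-Hausdorff estimate for the two medial axes\<close>

theorem theorem11p1:
  fixes K K' :: "'a::euclidean_space set"
    and \<alpha> \<alpha>' \<mu> lam \<epsilon> :: real
  assumes "closed K" and "bounded (- K)"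
    and "closed K'" and "bounded (- K')"
    and "\<alpha> > 0" and "0 < \<mu>" and "\<mu> \<le> 1" and "lam > 0"
    and "0 \<le> \<alpha>'" and "\<alpha>' < \<alpha>"
    and "r_mu \<mu> \<alpha>' K > ereal (\<alpha> + lam)"
    and "r_mu \<mu> \<alpha>' K' > ereal (\<alpha> + lam)"
    and "connected (- offset K \<alpha>)" and "connected (- offset K' \<alpha>)"
    and "hdist K K' < ereal \<epsilon>"
    and "\<epsilon> < (let Rm = max (Rmax K) (Rmax K');
                  mt = min (mu_tilde \<mu> lam \<alpha> \<alpha> K) (mu_tilde \<mu> lam \<alpha> \<alpha> K');
                  C = 22 / 3 * Rm\<^sup>2 / (sqrt \<alpha> * mt powr (3/2) * lam)
              in Min {lam\<^sup>2 * \<alpha> * mt / (16 * Rm\<^sup>2),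
                      lam\<^sup>2 / (16 * \<alpha> * mt),
                      9 * lam^4 * \<alpha> * mt^3 / (400 * Rm^4),
                      (2 * \<alpha> / C)\<^sup>2,
                      (lam\<^sup>2 * \<alpha> * mt / (16 * Rm\<^sup>2 * C))\<^sup>2,
                      (lam\<^sup>2 / (16 * \<alpha> * mt * C))\<^sup>2})"
  shows "(let Rm = max (Rmax K) (Rmax K');
              mt = min (mu_tilde \<mu> lam \<alpha> \<alpha> K) (mu_tilde \<mu> lam \<alpha> \<alpha> K');
              C = 22 / 3 * Rm\<^sup>2 / (sqrt \<alpha> * mt powr (3/2) * lam);
              A = medial_axis lam \<alpha> K; A' = medial_axis lam \<alpha> K';
              D = max (Gdiam A) (Gdiam A')
          in D < \<infinity> \<and>
             dGH A (\<lambda>x y. real_of_ereal (intrinsic_dist A x y))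
                 A' (\<lambda>x y. real_of_ereal (intrinsic_dist A' x y))
             \<le> ereal (2 * C powr (3/2) * \<epsilon> powr (1/4)
                      + 2 * C * sqrt \<epsilon> * exp (C powr (3/2) * \<epsilon> powr (1/4) / \<alpha>)
                      + real_of_ereal D * (exp (C powr (3/2) * \<epsilon> powr (1/4) / \<alpha>) - 1)))"
proof -
  define Rm mt C where "Rm = max (Rmax K) (Rmax K')"
    and "mt = min (mu_tilde \<mu> lam \<alpha> \<alpha> K) (mu_tilde \<mu> lam \<alpha> \<alpha> K')"
    and "C = 22 / 3 * Rm\<^sup>2 / (sqrt \<alpha> * mt powr (3/2) * lam)"
  define A A' where "A = medial_axis lam \<alpha> K" and "A' = medial_axis lam \<alpha> K'"
  define D where "D = max (Gdiam A) (Gdiam A')"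
  define T T2 where "T = C * sqrt \<epsilon>" and "T2 = C powr (3/2) * \<epsilon> powr (1/4)"
  define d d' where "d x y = real_of_ereal (intrinsic_dist A x y)"
    and "d' x y = real_of_ereal (intrinsic_dist A' x y)" for x y
  define B where "B = 2 * T2 + 2 * T * exp (T2 / \<alpha>) + real_of_ereal D * (exp (T2 / \<alpha>) - 1)"
  have ne: "K \<noteq> {}" "K' \<noteq> {}" using assms(2,4) by auto
  have near: "\<bar>Rdist K z - Rdist K' z\<bar> \<le> \<epsilon>" for z
    using Rdist_le_hdist[OF ne(2) assms(1) ne(1) assms(15), of z]
      Rdist_le_hdist[OF ne(1) assms(3) ne(2) assms(15)[unfolded hdist_commute[of K]], of z] by linarith
  have \<epsilon>: "0 < \<epsilon>"
  proof -
    obtain k where "k \<in> K" using ne by blast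
    then have "ereal (infdist k K') \<le> hdist K K'" unfolding hdist_def by (intro max.coboundedI1 SUP_upper)
    then have "ereal (infdist k K') < ereal \<epsilon>" using assms(15) by (rule order_le_less_trans)
    then show ?thesis using infdist_nonneg[of k K'] by simp
  qed
  interpret K: prox_flow K \<alpha> by unfold_locales (use assms(1,5) ne in auto)
  interpret K': prox_flow K' \<alpha> by unfold_locales (use assms(3,5) ne in auto)
  \<comment> \<open>Raising the lower end of the range from \<open>\<alpha>'\<close> to
    \<open>\<alpha>\<close> cannot decrease the infimum.\<close>
  have r: "ereal (\<alpha> + lam) < r_mu \<mu> \<alpha> K" "ereal (\<alpha> + lam) < r_mu \<mu> \<alpha> K'"
    using r_mu_mono[of \<alpha>' \<alpha> \<mu> K] r_mu_mono[of \<alpha>' \<alpha> \<mu> K'] assms(10-12) by auto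
  have mt: "0 < mt" "mt \<le> 1"
    using mu_tilde_bounds[OF assms(6-8) r(1)] mu_tilde_bounds[OF assms(6-8) r(2)] by (auto simp: mt_def)
  have grad: "mt \<le> norm (gradK K y)" if "\<alpha> < Rdist K y" "y \<notin> A" for y
    using K.mu_tilde_le_norm_gradK[OF assms(8) r(1) that(1)] that by (simp add: mt_def A_def)
  have grad': "mt \<le> norm (gradK K' y)" if "\<alpha> < Rdist K' y" "y \<notin> A'" for y
    using K'.mu_tilde_le_norm_gradK[OF assms(8) r(2) that(1)] that by (simp add: mt_def A'_def)
  have C0: "0 \<le> C" using assms(5,8) mt by (simp add: C_def)
  have T0: "0 \<le> T" "0 \<le> T2" using C0 \<epsilon> by (auto simp: T_def T2_def)
  have "D < \<infinity> \<and> dGH A d A' d' \<le> ereal B"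
  proof (cases "A = {} \<and> A' = {}")
    \<comment> \<open>With both axes empty the supremum \<open>D\<close> is
      \<open>-\<infinity>\<close>, which \<open>real_of_ereal\<close> sends to 0, and the empty
      relation serves for every positive bound.\<close>
    case True
    then have D: "D = - \<infinity>" by (simp add: D_def Gdiam_def bot_ereal_def)
    then have "0 \<le> B" using T0 by (simp add: B_def)
    have "dGH A d A' d' \<le> ereal B + ereal e" if "0 < e" for e
      unfolding dGH_def using True that \<open>0 \<le> B\<close>
      by (intro Inf_lower) (auto simp: eps_relation_def intro!: exI[of _ "{}"])
    then have "dGH A d A' d' \<le> ereal B" by (rule ereal_le_epsilon2)
    with D show ?thesis by simp
  next
    case False
    \<comment> \<open>At least one axis has a point, and its distance to the set bounds the
      corresponding maximum from below.\<close>
    have Rmle: "\<alpha> + lam \<le> Rm"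
    proof -
      have "\<alpha> + lam \<le> Rmax K" if "x \<in> A" for x
      proof -
        have "\<alpha> + lam \<le> Rdist K x" using K.medial_axis_Rdist[OF assms(8)] that by (simp add: A_def)
        moreover then have "x \<notin> K" using assms(5,8) by (auto simp: Rdist_def)
        ultimately show ?thesis using Rdist_le_Rmax[OF assms(1) ne(1) assms(2)] by fastforce
      qed
      moreover have "\<alpha> + lam \<le> Rmax K'" if "x \<in> A'" for x
      proof -
        have "\<alpha> + lam \<le> Rdist K' x" using K'.medial_axis_Rdist[OF assms(8)] that by (simp add: A'_def)
        moreover then have "x \<notin> K'" using assms(5,8) by (auto simp: Rdist_def)
        ultimately show ?thesis using Rdist_le_Rmax[OF assms(3) ne(2) assms(4)] by fastforce
      qed
      ultimately show ?thesis using False unfolding Rm_def by (metis all_not_in_conv max.coboundedI1 max.coboundedI2)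
    qed
    then have Rm0: "0 < Rm" using assms(5,8) by linarith
    have le: "Rdist K z \<le> Rm" for z
    proof (cases "z \<in> K")
      case True
      then have "Rdist K z = 0" by (simp add: Rdist_def)
      then show ?thesis using Rm0 by simp
    next
      case False
      from Rdist_le_Rmax[OF assms(1) ne(1) assms(2) this] show ?thesis by (simp add: Rm_def)
    qed
    have le': "Rdist K' z \<le> Rm" for z
    proof (cases "z \<in> K'")
      case True
      then have "Rdist K' z = 0" by (simp add: Rdist_def)
      then show ?thesis using Rm0 by simp
    next
      case False
      from Rdist_le_Rmax[OF assms(3) ne(2) assms(4) this] show ?thesis by (simp add: Rm_def)
    qed
    interpret F: medial_flow K \<alpha> lam mt Rm
      by unfold_locales (use assms(8) mt grad le Rmle in \<open>auto simp: A_def\<close>)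
    interpret F': medial_flow K' \<alpha> lam mt Rm
      by unfold_locales (use assms(8) mt grad' le' Rmle in \<open>auto simp: A'_def\<close>)
    have C: "F.holder_const = C" "F'.holder_const = C" by (simp_all add: F.holder_const_def F'.holder_const_def C_def)
    then have Cpos: "0 < C" using F.holder_const_pos by simp
    have min: "\<epsilon> < Min {lam\<^sup>2 * \<alpha> * mt / (16 * Rm\<^sup>2), lam\<^sup>2 / (16 * \<alpha> * mt),
        9 * lam^4 * \<alpha> * mt^3 / (400 * Rm^4), (2 * \<alpha> / C)\<^sup>2,
        (lam\<^sup>2 * \<alpha> * mt / (16 * Rm\<^sup>2 * C))\<^sup>2, (lam\<^sup>2 / (16 * \<alpha> * mt * C))\<^sup>2}"
      using assms(16) unfolding Let_def Rm_def[symmetric] mt_def[symmetric] C_def[symmetric] .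
    \<comment> \<open>The first bound admits \<open>\<epsilon>\<close> as closeness of the sets; the
      fifth puts \<open>C * sqrt \<epsilon>\<close> below the same threshold, for the second
      push.\<close>
    then have e1: "\<epsilon> < lam\<^sup>2 * \<alpha> * mt / (16 * Rm\<^sup>2)" and e5: "\<epsilon> < (lam\<^sup>2 * \<alpha> * mt / (16 * Rm\<^sup>2 * C))\<^sup>2"
      by simp_all
    have "sqrt \<epsilon> < lam\<^sup>2 * \<alpha> * mt / (16 * Rm\<^sup>2 * C)"
      using assms(5) mt Cpos by (intro real_less_lsqrt e5) auto
    then have Tlt: "T < lam\<^sup>2 * \<alpha> * mt / (16 * Rm\<^sup>2)"
      using Cpos Rm0 by (simp add: T_def field_simps)
    \<comment> \<open>The entry time for the displacement \<open>T\<close> is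
      \<open>C * sqrt (C * sqrt \<epsilon>)\<close>, the source of the exponents 3/2 and
      1/4.\<close>
    have T2: "T2 = C * sqrt T"
    proof -
      have "C * sqrt T = C powr 1 * (C powr (1/2) * (\<epsilon> powr (1/2)) powr (1/2))"
        using Cpos \<epsilon> by (simp add: T_def powr_half_sqrt[symmetric] powr_mult)
      also have "\<dots> = (C powr 1 * C powr (1/2)) * \<epsilon> powr (1/4)" by (simp only: powr_powr mult.assoc) simp
      also have "\<dots> = T2" unfolding powr_add[symmetric] by (simp add: T2_def)
      finally show ?thesis by simp
    qed
    have fin: "Gdiam A < \<infinity>" "Gdiam A' < \<infinity>"
      using F.Gdiam_medial_axis_finite F'.Gdiam_medial_axis_finite assms(2,4,13,14) by (auto simp: A_def A'_def)
    then have D: "D < \<infinity>" by (simp add: D_def max_def)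
    have dD: "intrinsic_dist A x y \<le> D" if "x \<in> A" "y \<in> A" for x y
      unfolding D_def Gdiam_def using that by (intro max.coboundedI1 Sup_upper) blast
    have dD': "intrinsic_dist A' x y \<le> D" if "x \<in> A'" "y \<in> A'" for x y
      unfolding D_def Gdiam_def using that by (intro max.coboundedI2 Sup_upper) blast
    have real_le: "i < \<infinity>" "real_of_ereal i \<le> real_of_ereal D" "0 \<le> real_of_ereal D"
      if "i \<le> D" "0 \<le> i" for i
      using that D by (cases i; cases D; auto)+
    have "D \<ge> 0"
      using False dD dD' intrinsic_dist_nonneg order_trans by (metis all_not_in_conv)
    then have D0: "0 \<le> real_of_ereal D" by (simp add: real_of_ereal_pos)
    have e1': "0 \<le> exp (T2 / \<alpha>) - 1" using T0 assms(5) by simp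
    then have B0: "0 \<le> B" unfolding B_def using T0 D0 by simp
    define Rel where "Rel = {(x, x'). x \<in> A \<and> x' \<in> A' \<and> dist x x' \<le> T}"
    have proj: "fst ` Rel = A" "snd ` Rel = A'"
    proof -
      have "\<exists>x'\<in>A'. dist x x' \<le> T" if "x \<in> A" for x
        using F'.medial_axis_near[OF \<epsilon> e1 assms(1) ne(1), of x] near that
        by (simp add: A_def A'_def T_def C abs_minus_commute)
      moreover have "\<exists>x\<in>A. dist x x' \<le> T" if "x' \<in> A'" for x'
        using F.medial_axis_near[OF \<epsilon> e1 assms(3) ne(2), of x'] near that
        by (simp add: A_def A'_def T_def C dist_commute)
      ultimately show "fst ` Rel = A" "snd ` Rel = A'" unfolding Rel_def by (force simp: image_iff)+
    qed
    \<comment> \<open>The multiplicative stretching of a distance \<open>r\<close> costs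
      \<open>r * (exp (T2 / \<alpha>) - 1)\<close>, which the diameter turns into an additive
      error.\<close>
    have B: "2 * T2 + exp (T2 / \<alpha>) * (2 * T + r) \<le> r + B" if "r \<le> real_of_ereal D" for r
      using mult_right_mono[OF that e1'] by (simp add: B_def algebra_simps)
    have close: "\<bar>d x y - d' x' y'\<bar> \<le> B" if "(x, x') \<in> Rel" "(y, y') \<in> Rel" for x y x' y'
    proof -
      have x: "x \<in> A" "x' \<in> A'" "dist x x' \<le> T" "dist x' x \<le> T"
        and y: "y \<in> A" "y' \<in> A'" "dist y y' \<le> T" "dist y' y \<le> T"
        using that by (auto simp: Rel_def dist_commute)
      note i = real_le[OF dD[OF x(1) y(1)] intrinsic_dist_nonneg]
        and i' = real_le[OF dD'[OF x(2) y(2)] intrinsic_dist_nonneg]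
      have "d x y \<le> 2 * T2 + exp (T2 / \<alpha>) * (2 * T + d' x' y')"
        using F.real_intrinsic_dist_transfer[OF \<epsilon> e1 assms(3) ne(2) near, unfolded C, OF T_def Tlt T2] x y i'(1)
        by (simp add: d_def d'_def A_def A'_def)
      then have 1: "d x y \<le> d' x' y' + B" using B[OF i'(2)] by (simp add: d'_def)
      have "d' x' y' \<le> 2 * T2 + exp (T2 / \<alpha>) * (2 * T + d x y)"
        using F'.real_intrinsic_dist_transfer[OF \<epsilon> e1 assms(1) ne(1) _, unfolded C, OF _ T_def Tlt T2] near x y i(1)
        by (simp add: d_def d'_def A_def A'_def abs_minus_commute)
      then have 2: "d' x' y' \<le> d x y + B" using B[OF i(2)] by (simp add: d_def)
      show ?thesis using 1 2 by linarith
    qed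
    \<comment> \<open>\<open>eps_relation\<close> asks for strict inequalities, so \<open>B\<close>
      is approached through \<open>B + e\<close>.\<close>
    have "dGH A d A' d' \<le> ereal B + ereal e" if "0 < e" for e
    proof -
      have "eps_relation A d A' d' (B + e) Rel"
        unfolding eps_relation_def
      proof (intro conjI proj ballI)
        show "Rel \<subseteq> A \<times> A'" by (auto simp: Rel_def)
        fix p assume p: "p \<in> Rel"
        obtain x x' where xx: "p = (x, x')" by (cases p)
        have "\<bar>d x y - d' x' y'\<bar> < B + e" if "(y, y') \<in> Rel" for y y'
          using close[OF p[unfolded xx] that] \<open>0 < e\<close> by linarith
        then show "case p of (x1, x2) \<Rightarrow> \<forall>(x1', x2') \<in> Rel. \<bar>d x1 x1' - d' x2 x2'\<bar> < B + e"
          unfolding xx by blast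
      qed
      then show ?thesis unfolding dGH_def using B0 that by (intro Inf_lower) auto
    qed
    then have "dGH A d A' d' \<le> ereal B" by (rule ereal_le_epsilon2)
    with D show ?thesis by simp
  qed
  then show ?thesis
    unfolding Let_def Rm_def[symmetric] mt_def[symmetric] C_def[symmetric] A_def[symmetric] A'_def[symmetric]
      D_def[symmetric] d_def[symmetric] d'_def[symmetric]
    by (simp add: B_def T_def T2_def mult.assoc)
qed

end
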